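(* Fix real numbers $c<d$. The following enveloping distances hold. (1) $E(\mathrm{(0)},\mathrm{(ffid^{[c,d]})})=\frac{d-c}{2}$ and $E(\mathrm{(ffid^{[c,d]})},\mathrm{(ffid)})=\infty^-$. Also $E(\mathrm{(0)},\mathrm{(ffid)})=\infty^-$, $E(\mathrm{(eph)},\mathrm{(ffid)})=\infty^-$ and $E(\mathrm{(eph)},\mathrm{(ffid^{[c,d]})})=\frac{d-c}{2}$. (2) $E(\mathrm{(cfid)},\mathrm{(fid)})=\infty$ and $E(\mathrm{(qtame)},\mathrm{(cfid)})=\infty$. (3) $E(\mathcal{A},\mathcal{B})=\infty$ for each of the following inclusions $\mathcal{A}\subset\mathcal{B}$: $\mathrm{(ffid)}\subset\mathrm{(fid)}$, $\mathrm{(ffid)}\subset\mathrm{(cfid)}$, $\mathrm{(cfid)}\subset\mathrm{(cid)}$, $\mathrm{(fid)}\subset\mathrm{(cid)}$, $\mathrm{(fid)}\subset\mathrm{(pfd)}$, $\mathrm{(cid)}\subset\mathrm{(id)}$, $\mathrm{(pfd)}\subset\mathrm{(id)}$, $\mathrm{(eph)}\subset\mathrm{(id)}$, $\mathrm{(eph)}\subset\mathrm{(qtame)}$, $\mathrm{(id)}\subset\mathrm{(pm)}$, $\mathrm{(qtame)}\subset\mathrm{(pm)}$. Also $E(\mathrm{(qtame)},\mathrm{(cid)})=\infty$.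
   Context: Fix a field $\mathbf{k}$. A persistence module is a functor $M:(\mathbb{R},\le)\to \mathrm{Vect}_{\mathbf{k}}$; "persistence module" means isomorphism class. For an interval $J\subset\mathbb{R}$, the interval module $J$ is $\mathbf{k}$ at points of $J$ and $0$ elsewhere, with identity maps between points of $J$ and zero maps otherwise. For $\varepsilon\ge 0$, $M,N$ are $\varepsilon$-interleaved if there are families of linear maps $\varphi_a:M(a)\to N(a+\varepsilon)$ and $\psi_a:N(a)\to M(a+\varepsilon)$, natural in $a\in\mathbb{R}$, with $\psi_{a+\varepsilon}\varphi_a=M(a\le a+2\varepsilon)$ and $\varphi_{a+\varepsilon}\psi_a=N(a\le a+2\varepsilon)$ for all $a$. Classes of persistence modules: $\mathrm{(pm)}$: all persistence modules; $\mathrm{(id)}$: those isomorphic to a direct sum $\bigoplus_{\alpha\in A}I_\alpha$ of interval modules, $A$ any index set; $\mathrm{(cid)}$: those in $\mathrm{(id)}$ with $A$ countable; $\mathrm{(cfid)}$: those in $\mathrm{(cid)}$ with all intervals finite (bounded); $\mathrm{(fid)}$: finite direct sums of interval modules (including the zero module); $\mathrm{(ffid)}$: those in $\mathrm{(fid)}$ with all intervals finite (bounded); $\mathrm{(ffid^{[c,d]})}$: those in $\mathrm{(ffid)}$ with all intervals contained in $[c,d]$; $\mathrm{(pfd)}$: all $M$ with every $M(a)$ finite dimensional; $\mathrm{(qtame)}$: all $M$ with $M(a<b)$ of finite rank for all $a<b$; $\mathrm{(eph)}$: all $M$ with $M(a<b)=0$ for all $a<b$; $\mathrm{(0)}$: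 only the zero module. The enveloping distance from a class $\mathcal{A}$ to a class $\mathcal{B}$ is $E(\mathcal{A},\mathcal{B})=\inf\{r\ge 0 : \forall B\in\mathcal{B}\ \forall s>r\ \exists A\in\mathcal{A} \text{ such that } A,B \text{ are } s\text{-interleaved}\}$. If no such $r$ exists, then one writes $E(\mathcal{A},\mathcal{B})=\infty^-$ if for every $B\in\mathcal{B}$ there exist $s$ and $A\in\mathcal{A}$ such that $A,B$ are $s$-interleaved, and $E(\mathcal{A},\mathcal{B})=\infty$ otherwise. *)

theory Defs
  imports "HOL-Analysis.Analysis" "HOL-Library.Function_Algebras"
begin

section \<open>Vector spaces\<close>

text \<open>
  The field is a type \<open>'k\<close> of class \<open>field\<close>. Since every vector space with a basis indexed by
  \<open>X\<close> embeds into the space of all functions from \<open>X\<close> to the field, vector spaces are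
  represented as linear subspaces of the function space \<open>'x \<Rightarrow> 'k\<close>. The type \<open>'x\<close> only bounds
  the size of the spaces; it is a parameter throughout.
\<close>

definition fscale :: "'k::field \<Rightarrow> ('x \<Rightarrow> 'k) \<Rightarrow> 'x \<Rightarrow> 'k" where
  "fscale c f = (\<lambda>x. c * f x)"

interpretation fun_vs: vector_space "fscale :: 'k::field \<Rightarrow> ('x \<Rightarrow> 'k) \<Rightarrow> 'x \<Rightarrow> 'k"
  by unfold_locales (auto simp: fscale_def algebra_simps fun_eq_iff)

text \<open>Linearity only constrains the values on the domain \<open>V\<close>.\<close>

definition linear_on ::
    "('x \<Rightarrow> 'k::field) set \<Rightarrow> ('y \<Rightarrow> 'k) set \<Rightarrow> (('x \<Rightarrow> 'k) \<Rightarrow> ('y \<Rightarrow> 'k)) \<Rightarrow> bool" where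
  "linear_on V W f \<longleftrightarrow>
     (\<forall>v\<in>V. f v \<in> W) \<and>
     (\<forall>u\<in>V. \<forall>v\<in>V. f (u + v) = f u + f v) \<and>
     (\<forall>c. \<forall>v\<in>V. f (fscale c v) = fscale c (f v))"

definition finite_dimensional :: "('x \<Rightarrow> 'k::field) set \<Rightarrow> bool" where
  "finite_dimensional V \<longleftrightarrow> (\<exists>B. finite B \<and> fun_vs.span B = V)"


section \<open>Persistence modules\<close>

text \<open>
  In \<open>transition M a b\<close> only the case \<open>a \<le> b\<close> and the values on \<open>space_at M a\<close> are meaningful.
\<close>

record ('k, 'x) pers =
  space_at :: "real \<Rightarrow> ('x \<Rightarrow> 'k) set"
  transition :: "real \<Rightarrow> real \<Rightarrow> ('x \<Rightarrow> 'k) \<Rightarrow> ('x \<Rightarrow> 'k)"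

definition persistence_module :: "('k::field, 'x) pers \<Rightarrow> bool" where
  "persistence_module M \<longleftrightarrow>
     (\<forall>a. fun_vs.subspace (space_at M a)) \<and>
     (\<forall>a b. a \<le> b \<longrightarrow> linear_on (space_at M a) (space_at M b) (transition M a b)) \<and>
     (\<forall>a. \<forall>v\<in>space_at M a. transition M a a v = v) \<and>
     (\<forall>a b c. a \<le> b \<longrightarrow> b \<le> c \<longrightarrow>
        (\<forall>v\<in>space_at M a. transition M b c (transition M a b v) = transition M a c v))"

definition pers_hom ::
    "real \<Rightarrow> ('k::field, 'x) pers \<Rightarrow> ('k, 'y) pers \<Rightarrow> (real \<Rightarrow> ('x \<Rightarrow> 'k) \<Rightarrow> ('y \<Rightarrow> 'k)) \<Rightarrow> bool" where
  "pers_hom \<epsilon> M N \<phi> \<longleftrightarrow>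
     (\<forall>a. linear_on (space_at M a) (space_at N (a + \<epsilon>)) (\<phi> a)) \<and>
     (\<forall>a b. a \<le> b \<longrightarrow>
        (\<forall>v\<in>space_at M a. \<phi> b (transition M a b v) = transition N (a + \<epsilon>) (b + \<epsilon>) (\<phi> a v)))"

definition isomorphic :: "('k::field, 'x) pers \<Rightarrow> ('k, 'y) pers \<Rightarrow> bool" where
  "isomorphic M N \<longleftrightarrow>
     (\<exists>\<phi>. pers_hom 0 M N \<phi> \<and> (\<forall>a. bij_betw (\<phi> a) (space_at M a) (space_at N a)))"

definition interleaved :: "real \<Rightarrow> ('k::field, 'x) pers \<Rightarrow> ('k, 'y) pers \<Rightarrow> bool" where
  "interleaved \<epsilon> M N \<longleftrightarrow> 0 \<le> \<epsilon> \<and>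
     (\<exists>\<phi> \<psi>. pers_hom \<epsilon> M N \<phi> \<and> pers_hom \<epsilon> N M \<psi> \<and>
        (\<forall>a. \<forall>v\<in>space_at M a. \<psi> (a + \<epsilon>) (\<phi> a v) = transition M a (a + 2 * \<epsilon>) v) \<and>
        (\<forall>a. \<forall>w\<in>space_at N a. \<phi> (a + \<epsilon>) (\<psi> a w) = transition N a (a + 2 * \<epsilon>) w))"

text \<open>The one-dimensional space is \<open>unit \<Rightarrow> 'k\<close>.\<close>

definition interval_module :: "real set \<Rightarrow> ('k::field, unit) pers" where
  "interval_module J =
     \<lparr>space_at = (\<lambda>a. if a \<in> J then UNIV else {0}),
      transition = (\<lambda>a b v. if a \<in> J \<and> b \<in> J then v else 0)\<rparr>"

text \<open>
  An element of the direct sum is a family of functions on \<open>'x\<close>, almost all zero, uncurried to one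
  function on \<open>'i \<times> 'x\<close>; the components at indices outside \<open>A\<close> are zero.
\<close>

definition direct_sum :: "'i set \<Rightarrow> ('i \<Rightarrow> ('k::field, 'x) pers) \<Rightarrow> ('k, 'i \<times> 'x) pers" where
  "direct_sum A M =
     \<lparr>space_at = (\<lambda>a. {f. (\<forall>i\<in>A. (\<lambda>x. f (i, x)) \<in> space_at (M i) a) \<and>
                          (\<forall>i. i \<notin> A \<longrightarrow> (\<lambda>x. f (i, x)) = 0) \<and>
                          finite {i. (\<lambda>x. f (i, x)) \<noteq> 0}}),
      transition = (\<lambda>a b f (i, x). if i \<in> A then transition (M i) a b (\<lambda>y. f (i, y)) x else 0)\<rparr>"

definition interval_decomposition ::
    "('k::field, 'x) pers \<Rightarrow> 'i set \<Rightarrow> ('i \<Rightarrow> real set) \<Rightarrow> bool" where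
  "interval_decomposition M A J \<longleftrightarrow>
     (\<forall>i\<in>A. is_interval (J i) \<and> J i \<noteq> {}) \<and>
     isomorphic M (direct_sum A (\<lambda>i. interval_module (J i)))"


section \<open>Classes of persistence modules\<close>

text \<open>
  A decomposition may use any index set. The type \<open>real \<times> ('x \<Rightarrow> 'k)\<close> below is only a choice of
  an index type that is large enough: see \<open>interval_decomposition_index\<close> at the end.
\<close>

type_synonym ('k, 'x) index = "real \<times> ('x \<Rightarrow> 'k)"

definition PM :: "('k::field, 'x) pers set" where
  "PM = {M. persistence_module M}"

definition ID :: "('k::field, 'x) pers set" where
  "ID = {M \<in> PM. \<exists>(A :: ('k, 'x) index set) J. interval_decomposition M A J}"

definition CID :: "('k::field, 'x) pers set" where
  "CID = {M \<in> PM. \<exists>(A :: ('k, 'x) index set) J. interval_decomposition M A J \<and> countable A}"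

definition CFID :: "('k::field, 'x) pers set" where
  "CFID = {M \<in> PM. \<exists>(A :: ('k, 'x) index set) J. interval_decomposition M A J \<and> countable A \<and>
             (\<forall>i\<in>A. bounded (J i))}"

definition FID :: "('k::field, 'x) pers set" where
  "FID = {M \<in> PM. \<exists>(A :: ('k, 'x) index set) J. interval_decomposition M A J \<and> finite A}"

definition FFID :: "('k::field, 'x) pers set" where
  "FFID = {M \<in> PM. \<exists>(A :: ('k, 'x) index set) J. interval_decomposition M A J \<and> finite A \<and>
             (\<forall>i\<in>A. bounded (J i))}"

definition FFID_in :: "real \<Rightarrow> real \<Rightarrow> ('k::field, 'x) pers set" where
  "FFID_in c d =
     {M \<in> PM. \<exists>(A :: ('k, 'x) index set) J. interval_decomposition M A J \<and> finite A \<and>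
        (\<forall>i\<in>A. bounded (J i) \<and> J i \<subseteq> {c..d})}"

definition PFD :: "('k::field, 'x) pers set" where
  "PFD = {M \<in> PM. \<forall>a. finite_dimensional (space_at M a)}"

definition QTAME :: "('k::field, 'x) pers set" where
  "QTAME = {M \<in> PM. \<forall>a b. a < b \<longrightarrow> finite_dimensional (transition M a b ` space_at M a)}"

definition EPH :: "('k::field, 'x) pers set" where
  "EPH = {M \<in> PM. \<forall>a b. a < b \<longrightarrow> (\<forall>v\<in>space_at M a. transition M a b v = 0)}"

definition ZERO :: "('k::field, 'x) pers set" where
  "ZERO = {M \<in> PM. \<forall>a. space_at M a = {0}}"


section \<open>The enveloping distance\<close>

datatype envdist = Fin real | Infty_minus | Infty

text \<open>
  The two classes may consist of modules of different sizes: for fixed \<open>'x\<close>, the type \<open>'y\<close> can be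
  taken arbitrarily large, so the approximating modules in \<open>\<A>\<close> need not be confined to the size
  of the modules in \<open>\<B>\<close>.
\<close>

definition envelops :: "('k::field, 'y) pers set \<Rightarrow> ('k, 'x) pers set \<Rightarrow> real \<Rightarrow> bool" where
  "envelops \<A> \<B> r \<longleftrightarrow> (\<forall>B\<in>\<B>. \<forall>s>r. \<exists>A\<in>\<A>. interleaved s A B)"

definition enveloping_distance ::
    "('k::field, 'y) pers set \<Rightarrow> ('k, 'x) pers set \<Rightarrow> envdist" where
  "enveloping_distance \<A> \<B> =
     (if \<exists>r\<ge>0. envelops \<A> \<B> r then Fin (Inf {r. 0 \<le> r \<and> envelops \<A> \<B> r})
      else if \<forall>B\<in>\<B>. \<exists>s. \<exists>A\<in>\<A>. interleaved s A B then Infty_minus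
      else Infty)"


section \<open>Independence of the index type\<close>

lemma isomorphic_trans:
  assumes "isomorphic M N" "isomorphic N P" shows "isomorphic M P"
proof -
  obtain f where f: "pers_hom 0 M N f" "\<And>a. bij_betw (f a) (space_at M a) (space_at N a)"
    using assms(1) unfolding isomorphic_def by blast
  obtain g where g: "pers_hom 0 N P g" "\<And>a. bij_betw (g a) (space_at N a) (space_at P a)"
    using assms(2) unfolding isomorphic_def by blast
  have "pers_hom 0 M P (\<lambda>a v. g a (f a v))"
    using f(1) g(1) unfolding pers_hom_def linear_on_def by simp
  moreover have "bij_betw (\<lambda>v. g a (f a v)) (space_at M a) (space_at P a)" for a
    using bij_betw_trans[OF f(2) g(2)] by (simp add: o_def)
  ultimately show ?thesis unfolding isomorphic_def by blast
qed

lemma direct_sum_reindex: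
  fixes N :: "'i \<Rightarrow> ('k::field, 'x) pers" and g :: "'i \<Rightarrow> 'j"
  assumes inj: "inj_on g A"
  shows "isomorphic (direct_sum A N) (direct_sum (g ` A) (\<lambda>j. N (inv_into A g j)))"
proof -
  define h where "h = inv_into A g"
  have hg: "h (g i) = i" if "i \<in> A" for i using that inj by (simp add: h_def)
  define R :: "('i \<times> 'x \<Rightarrow> 'k) \<Rightarrow> 'j \<times> 'x \<Rightarrow> 'k"
    where "R f = (\<lambda>(j, x). if j \<in> g ` A then f (h j, x) else 0)" for f
  define S :: "('j \<times> 'x \<Rightarrow> 'k) \<Rightarrow> 'i \<times> 'x \<Rightarrow> 'k"
    where "S f = (\<lambda>(i, x). if i \<in> A then f (g i, x) else 0)" for f
  let ?D = "direct_sum A N" and ?E = "direct_sum (g ` A) (\<lambda>j. N (h j))"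
  have Rm: "R f \<in> space_at ?E a" if "f \<in> space_at ?D a" for f a
  proof -
    have "{j. (\<lambda>x. R f (j, x)) \<noteq> 0} \<subseteq> g ` {i. (\<lambda>x. f (i, x)) \<noteq> 0}"
      by (auto simp: R_def hg fun_eq_iff intro!: imageI split: if_splits)
    moreover have "finite {i. (\<lambda>x. f (i, x)) \<noteq> 0}" using that by (simp add: direct_sum_def)
    ultimately have "finite {j. (\<lambda>x. R f (j, x)) \<noteq> 0}" by (meson finite_surj)
    then show ?thesis using that by (auto simp: direct_sum_def R_def hg fun_eq_iff)
  qed
  have Sm: "S f \<in> space_at ?D a" if "f \<in> space_at ?E a" for f a
  proof -
    have "g ` {i. (\<lambda>x. S f (i, x)) \<noteq> 0} \<subseteq> {j. (\<lambda>x. f (j, x)) \<noteq> 0}"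
      by (auto simp: S_def fun_eq_iff split: if_splits)
    moreover have "finite {j. (\<lambda>x. f (j, x)) \<noteq> 0}" using that by (simp add: direct_sum_def)
    ultimately have "finite (g ` {i. (\<lambda>x. S f (i, x)) \<noteq> 0})" by (rule finite_subset)
    moreover have "inj_on g {i. (\<lambda>x. S f (i, x)) \<noteq> 0}"
      by (rule inj_on_subset[OF inj]) (auto simp: S_def fun_eq_iff split: if_splits)
    ultimately have "finite {i. (\<lambda>x. S f (i, x)) \<noteq> 0}" by (rule finite_imageD)
    then show ?thesis using that by (auto simp: direct_sum_def S_def hg fun_eq_iff)
  qed
  have SR: "S (R f) = f" if "f \<in> space_at ?D a" for f a
    using that by (auto simp: direct_sum_def S_def R_def hg fun_eq_iff)
  have RS: "R (S f) = f" if "f \<in> space_at ?E a" for f a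
    using that by (auto simp: direct_sum_def S_def R_def hg fun_eq_iff)
  have "bij_betw R (space_at ?D a) (space_at ?E a)" for a
    by (rule bij_betw_byWitness[where f' = S]) (use Rm Sm SR RS in auto)
  moreover have "pers_hom 0 ?D ?E (\<lambda>a. R)"
  proof -
    have "R (u + v) = R u + R v" "R (fscale c v) = fscale c (R v)" for u v c
      by (auto simp: fun_eq_iff R_def fscale_def)
    moreover have "R (transition ?D a b v) = transition ?E a b (R v)" for a b v
      by (auto simp: fun_eq_iff R_def direct_sum_def hg)
    ultimately show ?thesis
      unfolding pers_hom_def linear_on_def using Rm by simp
  qed
  ultimately show ?thesis unfolding isomorphic_def h_def by blast
qed

lemma interval_decomposition_index:
  fixes M :: "('k::field, 'x) pers" and A :: "'i set"
  assumes "interval_decomposition M A J"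
  shows "\<exists>g :: 'i \<Rightarrow> ('k, 'x) index. inj_on g A \<and>
           interval_decomposition M (g ` A) (\<lambda>j. J (inv_into A g j))"
proof -
  let ?D = "direct_sum A (\<lambda>i. interval_module (J i) :: ('k, unit) pers)"
  have J: "is_interval (J i)" "J i \<noteq> {}" if "i \<in> A" for i
    using assms that by (auto simp: interval_decomposition_def)
  have iso: "isomorphic M ?D" using assms by (simp add: interval_decomposition_def)
  then obtain \<phi> where \<phi>: "\<And>a. bij_betw (\<phi> a) (space_at M a) (space_at ?D a)"
    unfolding isomorphic_def by blast
  define e :: "'i \<Rightarrow> 'i \<times> unit \<Rightarrow> 'k" where "e i = (\<lambda>(j, _). if j = i then 1 else 0)" for i
  define p where "p i = (SOME a. a \<in> J i)" for i
  have p: "p i \<in> J i" if "i \<in> A" for i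
    using J(2)[OF that] by (simp add: p_def some_in_eq)
  have e: "e i \<in> space_at ?D (p i)" if "i \<in> A" for i
  proof -
    have "{j. (\<lambda>x. e i (j, x)) \<noteq> 0} \<subseteq> {i}" by (auto simp: e_def fun_eq_iff)
    then have "finite {j. (\<lambda>x. e i (j, x)) \<noteq> 0}" by (meson finite.simps finite_subset)
    then show ?thesis
      using that p[OF that] by (auto simp: direct_sum_def interval_module_def e_def fun_eq_iff)
  qed
  define g where "g i = (p i, inv_into (space_at M (p i)) (\<phi> (p i)) (e i))" for i
  have ev: "\<phi> (p i) (snd (g i)) = e i" if "i \<in> A" for i
    using e[OF that] bij_betw_imp_surj_on[OF \<phi>, of "p i"]
    by (simp add: g_def f_inv_into_f)
  have inj: "inj_on g A"
  proof (rule inj_onI)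
    fix i j assume ij: "i \<in> A" "j \<in> A" "g i = g j"
    then have "p i = p j" by (simp add: g_def)
    with ij ev[of i] ev[of j] have "e i = e j" by simp
    then have "e i (i, ()) = e j (i, ())" by simp
    then show "i = j" by (simp add: e_def split: if_splits)
  qed
  have "interval_decomposition M (g ` A) (\<lambda>j. J (inv_into A g j))"
    unfolding interval_decomposition_def
    using J inj isomorphic_trans[OF iso direct_sum_reindex[OF inj]] by auto
  with inj show ?thesis by blast
qed

end

theory Submission
  imports Defs
begin

text \<open>
  If \<open>A\<close> and \<open>B\<close> are \<open>s\<close>-interleaved, every structure map of \<open>B\<close> over a length of at least \<open>2 * s\<close>
  factors through a space of \<open>A\<close>, and over a longer length through a structure map of \<open>A\<close>
  (\<open>interleaved_factors\<close>). All lower bounds come from a module \<open>B\<close> whose long structure maps are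
  too big for such a factorisation.

  For the finite value, the interval module of \<open>{c..d}\<close> has a nonzero map of length \<open>d - c\<close>, whereas
  ephemeral modules have only zero maps of positive length; so no \<open>s < (d - c) / 2\<close> is possible.
  Conversely a module with intervals in \<open>{c..d}\<close> has zero maps over every length above \<open>d - c\<close> and is
  therefore interleaved with the zero module. As a finite sum of bounded intervals has all its
  intervals in some \<open>{c..d}\<close>, and bounded intervals can be arbitrarily long, the remaining distances
  in the first part are \<open>Infty_minus\<close>.

  Each value \<open>Infty\<close> is witnessed by a single module at no finite distance from any member of the
  approximating class. Let \<open>g\<close> be an injective sequence in the index type.
  \<^item> The interval module of the whole line is far from \<open>CFID\<close>, \<open>FFID\<close> and \<open>EPH\<close>: in those modules every
    element dies eventually, but in the line none does.
  \<^item> The sum of the intervals \<open>{0..n}\<close> has structure maps of infinite rank over every length, so it is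
    far from \<open>QTAME\<close>, hence from \<open>PFD\<close>, and from \<open>FID\<close> and \<open>FFID\<close>.
  \<^item> The sum of the intervals \<open>{n..}\<close> is pointwise finite-dimensional, but its ranks are unbounded; a
    finite sum of intervals bounds all ranks by the number of summands.
  \<^item> The constant module on the space of all sequences is a sum of copies of the line. Its rank is
    uncountable (\<open>supported_not_countably_spanned\<close>), so it is far from countable sums.
  \<^item> The space of all sequences, with the sequences vanishing before position \<open>- a\<close> as the space at
    time \<open>a < 0\<close>, is far from all sums of intervals
    (\<open>interval_sum_not_interleaved_filtered_sequences\<close>). Each quotient by a step of the filtration is
    finite-dimensional and the intersection of all steps is zero, which leaves a sum of intervals
    interleaved with it only countably many summands that matter; yet these would have to span the
    space of all sequences.
\<close>

section \<open>Coordinate vectors and dimension\<close>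

definition unit_vec :: "'x \<Rightarrow> 'x \<Rightarrow> 'k::field" where
  "unit_vec x = (\<lambda>y. if y = x then 1 else 0)"

definition supported :: "'x set \<Rightarrow> ('x \<Rightarrow> 'k::field) set" where
  "supported X = {f. \<forall>x. f x \<noteq> 0 \<longrightarrow> x \<in> X}"

definition fin_supported :: "'x set \<Rightarrow> ('x \<Rightarrow> 'k::field) set" where
  "fin_supported X = {f \<in> supported X. finite {x. f x \<noteq> 0}}"

lemma sum_fun_apply: "(\<Sum>i\<in>I. F i) x = (\<Sum>i\<in>I. F i x)"
  by (induction I rule: infinite_finite_induct) auto

lemma subspace_supported: "fun_vs.subspace (supported X)"
  by (auto simp: fun_vs.subspace_def supported_def fscale_def) (metis add.right_neutral)

lemma subspace_fin_supported: "fun_vs.subspace (fin_supported X :: ('x \<Rightarrow> 'k::field) set)"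
proof -
  have "finite {x. (f + g) x \<noteq> 0}" if "finite {x. f x \<noteq> 0}" "finite {x. g x \<noteq> 0}"
    for f g :: "'x \<Rightarrow> 'k"
    by (rule finite_subset[OF _ finite_UnI[OF that]]) auto
  then show ?thesis
    using subspace_supported[of X]
    by (auto simp: fun_vs.subspace_def fin_supported_def fscale_def)
qed

lemma unit_vec_in_fin_supported: "x \<in> X \<Longrightarrow> unit_vec x \<in> fin_supported X"
  by (auto simp: fin_supported_def supported_def unit_vec_def)

lemma fin_supported_eq_span:
  "(fin_supported X :: ('x \<Rightarrow> 'k::field) set) = fun_vs.span (unit_vec ` X)"
proof
  show "fin_supported X \<subseteq> fun_vs.span (unit_vec ` X :: ('x \<Rightarrow> 'k) set)"
  proof
    fix f :: "'x \<Rightarrow> 'k" assume f: "f \<in> fin_supported X"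
    have "f = (\<Sum>x\<in>{x. f x \<noteq> 0}. fscale (f x) (unit_vec x))"
      using f by (auto simp: fun_eq_iff sum_fun_apply fscale_def unit_vec_def fin_supported_def
          if_distrib cong: if_cong)
    moreover have "(\<Sum>x\<in>{x. f x \<noteq> 0}. fscale (f x) (unit_vec x)) \<in> fun_vs.span (unit_vec ` X)"
      using f by (intro fun_vs.span_sum fun_vs.span_scale fun_vs.span_base)
        (auto simp: fin_supported_def supported_def)
    ultimately show "f \<in> fun_vs.span (unit_vec ` X)" by simp
  qed
  show "fun_vs.span (unit_vec ` X) \<subseteq> (fin_supported X :: ('x \<Rightarrow> 'k) set)"
    by (rule fun_vs.span_minimal[OF _ subspace_fin_supported])
      (auto intro: unit_vec_in_fin_supported)
qed

lemma fin_supported_finite: "finite X \<Longrightarrow> fin_supported X = supported X"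
  by (auto simp: fin_supported_def supported_def intro: finite_subset)

text \<open>
  Evaluating a vanishing linear combination at the point that singles out one of its vectors leaves
  only the coefficient of that vector.
\<close>

lemma independent_by_separating_points:
  fixes S :: "('x \<Rightarrow> 'k::field) set"
  assumes sep: "\<And>F v. finite F \<Longrightarrow> F \<subseteq> S \<Longrightarrow> v \<in> F \<Longrightarrow> \<exists>x. v x \<noteq> 0 \<and> (\<forall>w\<in>F - {v}. w x = 0)"
  shows "fun_vs.independent S"
  unfolding fun_vs.independent_explicit_module
proof (intro allI impI)
  fix F u v assume F: "finite F" "F \<subseteq> S" "(\<Sum>w\<in>F. fscale (u w) w) = 0" "v \<in> F"
  obtain x where x: "v x \<noteq> 0" "\<forall>w\<in>F - {v}. w x = 0" using sep[of F v] F by blast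
  have "(\<Sum>w\<in>F. fscale (u w) w) x = u v * v x + (\<Sum>w\<in>F - {v}. u w * w x)"
    using F(1,4) by (simp add: sum_fun_apply fscale_def sum.remove)
  also have "(\<Sum>w\<in>F - {v}. u w * w x) = 0" using x by (intro sum.neutral) auto
  finally have "u v * v x = (\<Sum>w\<in>F. fscale (u w) w) x" by simp
  also have "\<dots> = 0" unfolding F(3) by simp
  finally show "u v = 0" using x(1) by simp
qed

lemma inj_unit_vec: "inj (unit_vec :: 'x \<Rightarrow> 'x \<Rightarrow> 'k::field)"
  by (rule injI) (metis unit_vec_def zero_neq_one)

lemma independent_unit_vecs: "fun_vs.independent (unit_vec ` X :: ('x \<Rightarrow> 'k::field) set)"
proof (rule independent_by_separating_points)
  fix F and v :: "'x \<Rightarrow> 'k" assume "F \<subseteq> unit_vec ` X" "v \<in> F"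
  then obtain x where "v = unit_vec x" by auto
  then have "v x \<noteq> 0 \<and> (\<forall>w\<in>F - {v}. w x = 0)"
    using \<open>F \<subseteq> _\<close> by (fastforce simp: unit_vec_def)
  then show "\<exists>x. v x \<noteq> 0 \<and> (\<forall>w\<in>F - {v}. w x = 0)" by blast
qed

lemma card_le_of_unit_vecs_in_span:
  fixes C :: "('x \<Rightarrow> 'k::field) set"
  assumes "finite C" "unit_vec ` X \<subseteq> fun_vs.span C"
  shows "finite X" "card X \<le> card C"
proof -
  have "finite (unit_vec ` X :: ('x \<Rightarrow> 'k) set) \<and> card (unit_vec ` X :: ('x \<Rightarrow> 'k) set) \<le> card C"
    using fun_vs.independent_span_bound[OF assms(1) independent_unit_vecs assms(2)] .
  moreover have "inj_on (unit_vec :: 'x \<Rightarrow> 'x \<Rightarrow> 'k) X"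
    using inj_unit_vec by (rule inj_on_subset) simp
  ultimately show "finite X" "card X \<le> card C"
    by (auto simp: card_image dest: finite_imageD)
qed

text \<open>
  A countable set has only countably many finite subsets, and the span of each of them contains only
  finitely many members of an independent set.
\<close>

lemma countable_independent_in_countable_span:
  fixes C S :: "('x \<Rightarrow> 'k::field) set"
  assumes "countable C" "fun_vs.independent S" "S \<subseteq> fun_vs.span C"
  shows "countable S"
proof -
  let ?\<F> = "{F. finite F \<and> F \<subseteq> C}"
  have "S \<subseteq> (\<Union>F\<in>?\<F>. S \<inter> fun_vs.span F)"
  proof
    fix v assume v: "v \<in> S"
    then obtain t r where t: "finite t" "t \<subseteq> C" "v = (\<Sum>a\<in>t. fscale (r a) a)"
      using assms(3) by (auto simp: fun_vs.span_explicit)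
    then have "v \<in> fun_vs.span t"
      by (auto intro!: fun_vs.span_sum fun_vs.span_scale intro: fun_vs.span_base)
    with t v show "v \<in> (\<Union>F\<in>?\<F>. S \<inter> fun_vs.span F)" by blast
  qed
  moreover have "finite (S \<inter> fun_vs.span F)" if "F \<in> ?\<F>" for F
    using that fun_vs.independent_span_bound[of F "S \<inter> fun_vs.span F"]
      fun_vs.independent_mono[OF assms(2)] by auto
  moreover have "countable ?\<F>"
    using countable_Collect_finite_subset[OF assms(1)] .
  ultimately show ?thesis
    by (meson countable_UN countable_finite countable_subset)
qed

text \<open>
  The space of all sequences has uncountable dimension over every field, even a finite one. The
  reason is an uncountable almost disjoint family: each real \<open>r\<close> gives the infinite set of codes of
  the pairs \<open>(n, \<lfloor>n * r\<rfloor>)\<close>, and for two reals these sets have only finitely many common members.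
  The indicator functions of such sets are linearly independent.
\<close>

lemma supported_not_countably_spanned:
  fixes g :: "nat \<Rightarrow> 'x" and C :: "('x \<Rightarrow> 'k::field) set"
  assumes g: "inj g" and C: "countable C"
  shows "\<not> supported (range g) \<subseteq> fun_vs.span C"
proof
  assume sub: "supported (range g) \<subseteq> fun_vs.span C"
  define p where "p r n = g (to_nat (n, \<lfloor>real n * r\<rfloor>))" for r n
  define v :: "real \<Rightarrow> 'x \<Rightarrow> 'k" where "v r = (\<lambda>x. if x \<in> range (p r) then 1 else 0)" for r
  have p_eq: "p r n = p r' n' \<longleftrightarrow> n = n' \<and> \<lfloor>real n * r\<rfloor> = \<lfloor>real n' * r'\<rfloor>" for r r' n n'
    using g by (auto simp: p_def inj_eq)
  have ev: "\<forall>\<^sub>F n in sequentially. v r' (p r n) = 0" if "r \<noteq> r'" for r r'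
  proof -
    obtain N :: nat where N: "1 / \<bar>r - r'\<bar> < real N" using reals_Archimedean2 by blast
    have "v r' (p r n) = 0" if "n \<ge> N" for n
    proof -
      \<comment> \<open>Two numbers at distance above 1 have different floors.\<close>
      have "1 < real n * \<bar>r - r'\<bar>"
        using N that \<open>r \<noteq> r'\<close> by (simp add: divide_simps) (smt (verit) mult_right_mono of_nat_mono)
      then have "1 < \<bar>real n * r - real n * r'\<bar>"
        by (simp add: abs_mult flip: right_diff_distrib)
      then have "\<lfloor>real n * r\<rfloor> \<noteq> \<lfloor>real n * r'\<rfloor>" by linarith
      then show ?thesis by (auto simp: v_def p_eq)
    qed
    then show ?thesis by (auto simp: eventually_sequentially)
  qed
  have v1: "v r (p r n) = 1" for r n by (simp add: v_def)
  have ind: "fun_vs.independent (range v)"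
  proof (rule independent_by_separating_points)
    fix F u assume F: "finite F" "F \<subseteq> range v" "u \<in> F"
    then obtain r where r: "u = v r" by auto
    have "\<forall>\<^sub>F n in sequentially. \<forall>w\<in>F - {u}. w (p r n) = 0"
      using F(1)
    proof (intro eventually_ball_finite ballI)
      fix w assume w: "w \<in> F - {u}"
      then obtain r' where "w = v r'" using F by auto
      with w r show "\<forall>\<^sub>F n in sequentially. w (p r n) = 0" using ev[of r r'] by auto
    qed simp
    then obtain n where "\<forall>w\<in>F - {u}. w (p r n) = 0" by (auto simp: eventually_sequentially)
    with v1 r show "\<exists>x. u x \<noteq> 0 \<and> (\<forall>w\<in>F - {u}. w x = 0)" by (metis zero_neq_one)
  qed
  have "inj v"
  proof (rule injI, rule ccontr)
    fix r r' assume "v r = v r'" "r \<noteq> r'"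
    then show False using ev[of r r'] v1[of r] by (auto simp: eventually_sequentially)
  qed
  then have "uncountable (range v)"
    using uncountable_UNIV_real countable_image_inj_on by blast
  moreover have "range v \<subseteq> fun_vs.span C"
    using sub by (rule subset_trans[rotated]) (auto simp: supported_def v_def p_def split: if_splits)
  ultimately show False
    using countable_independent_in_countable_span[OF C ind] by blast
qed

section \<open>Linear maps on subspaces\<close>

lemma linear_on_zero:
  assumes "linear_on V W f" "0 \<in> V"
  shows "f 0 = 0"
proof -
  have "f (fscale 0 0) = fscale 0 (f 0)" using assms unfolding linear_on_def by blast
  then show ?thesis by (simp only: fun_vs.scale_zero_left)
qed

lemma linear_on_image_span:
  fixes f :: "('x \<Rightarrow> 'k::field) \<Rightarrow> ('y \<Rightarrow> 'k)"
  assumes f: "linear_on V W f" and V: "fun_vs.subspace V" and S: "S \<subseteq> V"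
  shows "f ` fun_vs.span S = fun_vs.span (f ` S)"
proof
  have sV: "fun_vs.span S \<subseteq> V" using S V by (rule fun_vs.span_minimal)
  have f0: "f 0 = 0" using linear_on_zero[OF f fun_vs.subspace_0[OF V]] .
  show "f ` fun_vs.span S \<subseteq> fun_vs.span (f ` S)"
  proof -
    have "fun_vs.subspace {v \<in> V. f v \<in> fun_vs.span (f ` S)}"
      using V f0 f by (auto simp: fun_vs.subspace_def linear_on_def fun_vs.span_zero
          intro: fun_vs.span_add fun_vs.span_scale)
    moreover have "S \<subseteq> {v \<in> V. f v \<in> fun_vs.span (f ` S)}"
      using S by (auto intro: fun_vs.span_base)
    ultimately have "fun_vs.span S \<subseteq> {v \<in> V. f v \<in> fun_vs.span (f ` S)}"
      using fun_vs.span_minimal by metis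
    then show ?thesis by auto
  qed
  have "fun_vs.subspace (f ` fun_vs.span S)"
    unfolding fun_vs.subspace_def
  proof (intro conjI ballI allI)
    show "0 \<in> f ` fun_vs.span S" using f0 fun_vs.span_zero by (metis image_eqI)
  next
    fix x y assume "x \<in> f ` fun_vs.span S" "y \<in> f ` fun_vs.span S"
    then obtain u v where uv: "u \<in> fun_vs.span S" "v \<in> fun_vs.span S" "x = f u" "y = f v" by blast
    moreover have "u \<in> V" "v \<in> V" using uv sV by auto
    ultimately have "x + y = f (u + v)" using f by (simp add: linear_on_def)
    then show "x + y \<in> f ` fun_vs.span S" using uv fun_vs.span_add by blast
  next
    fix c x assume "x \<in> f ` fun_vs.span S"
    then obtain u where u: "u \<in> fun_vs.span S" "x = f u" by blast
    moreover have "u \<in> V" using u sV by auto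
    ultimately have "fscale c x = f (fscale c u)" using f by (simp add: linear_on_def)
    then show "fscale c x \<in> f ` fun_vs.span S" using u fun_vs.span_scale by blast
  qed
  then show "fun_vs.span (f ` S) \<subseteq> f ` fun_vs.span S"
    by (rule fun_vs.span_minimal[rotated]) (auto simp: fun_vs.span_base)
qed

lemma finite_dimensional_image:
  assumes "linear_on V W f" "fun_vs.subspace V" "finite_dimensional V"
  shows "finite_dimensional (f ` V)"
proof -
  obtain F where F: "finite F" "fun_vs.span F = V"
    using assms(3) by (auto simp: finite_dimensional_def)
  then have "f ` V = fun_vs.span (f ` F)"
    using linear_on_image_span[OF assms(1,2), of F] fun_vs.span_superset by blast
  with F show ?thesis by (auto simp: finite_dimensional_def)
qed

section \<open>Interleavings and isomorphisms\<close>

lemma PM_D: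
  assumes "M \<in> PM"
  shows "fun_vs.subspace (space_at M a)"
    and "a \<le> b \<Longrightarrow> linear_on (space_at M a) (space_at M b) (transition M a b)"
    and "v \<in> space_at M a \<Longrightarrow> transition M a a v = v"
    and "a \<le> b \<Longrightarrow> b \<le> c \<Longrightarrow> v \<in> space_at M a \<Longrightarrow>
           transition M b c (transition M a b v) = transition M a c v"
    and "a \<le> b \<Longrightarrow> v \<in> space_at M a \<Longrightarrow> transition M a b v \<in> space_at M b"
    and "0 \<in> space_at M a"
proof -
  show "fun_vs.subspace (space_at M a)" using assms by (auto simp: PM_def persistence_module_def)
  then show "0 \<in> space_at M a" by (rule fun_vs.subspace_0)
qed (use assms in \<open>auto simp: PM_def persistence_module_def linear_on_def\<close>)

text \<open>
  Linearity and naturality of the inverse need the domain to be closed under the vector operations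
  and the structure maps, which is why \<open>M\<close> is required to be a persistence module.
\<close>

lemma isomorphic_inverse:
  assumes M: "M \<in> PM" and "isomorphic M N"
  obtains f h where "pers_hom 0 M N f" "pers_hom 0 N M h"
    "\<And>a v. v \<in> space_at M a \<Longrightarrow> h a (f a v) = v"
    "\<And>a w. w \<in> space_at N a \<Longrightarrow> f a (h a w) = w"
proof -
  obtain f where f: "pers_hom 0 M N f" "\<And>a. bij_betw (f a) (space_at M a) (space_at N a)"
    using assms(2) unfolding isomorphic_def by blast
  define h where "h a = inv_into (space_at M a) (f a)" for a
  have hm: "h a w \<in> space_at M a" if "w \<in> space_at N a" for a w
    using bij_betwE[OF bij_betw_inv_into[OF f(2)]] that by (simp add: h_def)
  have fh: "f a (h a w) = w" if "w \<in> space_at N a" for a w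
    using f(2)[of a] that by (simp add: h_def bij_betw_inv_into_right)
  have hf: "h a (f a v) = v" if "v \<in> space_at M a" for a v
    using f(2)[of a] that by (simp add: h_def bij_betw_inv_into_left)
  have hI: "h a w = v" if "v \<in> space_at M a" "f a v = w" for a v w
    using hf that by blast
  note f1 = f(1)[unfolded pers_hom_def linear_on_def, simplified]
  have "pers_hom 0 N M h"
    unfolding pers_hom_def linear_on_def add_0_right
  proof (intro conjI allI ballI impI)
    fix a u v assume "u \<in> space_at N a" "v \<in> space_at N a"
    then show "h a (u + v) = h a u + h a v"
      using f1 fh hm PM_D(1)[OF M] by (intro hI) (simp_all add: fun_vs.subspace_add)
  next
    fix a c v assume "v \<in> space_at N a"
    then show "h a (fscale c v) = fscale c (h a v)"
      using f1 fh hm PM_D(1)[OF M] by (intro hI) (simp_all add: fun_vs.subspace_scale)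
  next
    fix a b w assume ab: "a \<le> b" and w: "w \<in> space_at N a"
    show "h b (transition N a b w) = transition M a b (h a w)"
      using ab f1 fh[OF w] hm[OF w] PM_D(5)[OF M] by (intro hI) auto
  qed (auto simp: hm)
  with that f(1) hf fh show ?thesis by blast
qed

lemma isomorphic_sym:
  assumes M: "M \<in> PM" and "isomorphic M N"
  shows "isomorphic N M"
proof -
  obtain f h where fh: "pers_hom 0 M N f" "pers_hom 0 N M h"
    "\<And>a v. v \<in> space_at M a \<Longrightarrow> h a (f a v) = v"
    "\<And>a w. w \<in> space_at N a \<Longrightarrow> f a (h a w) = w"
    using isomorphic_inverse[OF assms] by metis
  have "bij_betw (h a) (space_at N a) (space_at M a)" for a
    using fh by (intro bij_betw_byWitness[where f' = "f a"])
      (auto simp: pers_hom_def linear_on_def)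
  with fh(2) show ?thesis unfolding isomorphic_def by blast
qed

lemma interleaved_isomorphic:
  assumes M: "M \<in> PM" and iso: "isomorphic M N" and int: "interleaved s M B"
  shows "interleaved s N B"
proof -
  obtain \<phi> \<psi> where \<phi>: "pers_hom s M B \<phi>" and \<psi>: "pers_hom s B M \<psi>" and s: "0 \<le> s"
    and c: "\<And>a v. v \<in> space_at M a \<Longrightarrow> \<psi> (a + s) (\<phi> a v) = transition M a (a + 2 * s) v"
      "\<And>a w. w \<in> space_at B a \<Longrightarrow> \<phi> (a + s) (\<psi> a w) = transition B a (a + 2 * s) w"
    using int unfolding interleaved_def by blast
  obtain f h where fh: "pers_hom 0 M N f" "pers_hom 0 N M h"
    "\<And>a v. v \<in> space_at M a \<Longrightarrow> h a (f a v) = v"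
    "\<And>a w. w \<in> space_at N a \<Longrightarrow> f a (h a w) = w"
    using isomorphic_inverse[OF M iso] by metis
  define \<phi>' \<psi>' where "\<phi>' = (\<lambda>a v. \<phi> a (h a v))" and "\<psi>' = (\<lambda>a w. f (a + s) (\<psi> a w))"
  have "pers_hom s N B \<phi>'" "pers_hom s B N \<psi>'"
    using fh(1,2) \<phi> \<psi> unfolding pers_hom_def linear_on_def \<phi>'_def \<psi>'_def by simp_all
  moreover have "\<psi>' (a + s) (\<phi>' a v) = transition N a (a + 2 * s) v"
    if v: "v \<in> space_at N a" for a v
  proof -
    have hv: "h a v \<in> space_at M a" using fh(2) v by (simp add: pers_hom_def linear_on_def)
    have "\<psi>' (a + s) (\<phi>' a v) = f (a + 2 * s) (transition M a (a + 2 * s) (h a v))"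
      using c(1)[OF hv] by (simp add: \<phi>'_def \<psi>'_def algebra_simps)
    also have "\<dots> = transition N a (a + 2 * s) (f a (h a v))"
      using fh(1) hv s by (simp add: pers_hom_def)
    finally show ?thesis using fh(4)[OF v] by simp
  qed
  moreover have "\<phi>' (a + s) (\<psi>' a w) = transition B a (a + 2 * s) w"
    if w: "w \<in> space_at B a" for a w
    using c(2)[OF w] fh(3) \<psi> w by (simp add: \<phi>'_def \<psi>'_def pers_hom_def linear_on_def)
  ultimately show ?thesis using s unfolding interleaved_def by blast
qed

text \<open>
  A structure map of \<open>B\<close> of length at least \<open>2 * s\<close> can be rerouted through \<open>A\<close>, and naturality of the
  map from \<open>A\<close> to \<open>B\<close> lets all of the length beyond \<open>2 * s\<close> be spent in \<open>A\<close>. Properties of the structure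
  maps of \<open>A\<close>, such as vanishing or small rank, therefore pass to those of \<open>B\<close>.
\<close>

lemma interleaved_factors:
  assumes B: "B \<in> PM" and int: "interleaved s A B"
  obtains \<phi> \<psi> where
    "\<And>a. linear_on (space_at A a) (space_at B (a + s)) (\<phi> a)"
    "\<And>a. linear_on (space_at B a) (space_at A (a + s)) (\<psi> a)"
    "\<And>a b w. w \<in> space_at B a \<Longrightarrow> a + s \<le> b \<Longrightarrow>
       transition B a (b + s) w = \<phi> b (transition A (a + s) b (\<psi> a w))"
proof -
  obtain \<phi> \<psi> where \<phi>: "pers_hom s A B \<phi>" and \<psi>: "pers_hom s B A \<psi>" and s: "0 \<le> s"
    and c: "\<And>a w. w \<in> space_at B a \<Longrightarrow> \<phi> (a + s) (\<psi> a w) = transition B a (a + 2 * s) w"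
    using int unfolding interleaved_def by blast
  have "transition B a (b + s) w = \<phi> b (transition A (a + s) b (\<psi> a w))"
    if w: "w \<in> space_at B a" and b: "a + s \<le> b" for a b w
  proof -
    have "\<phi> b (transition A (a + s) b (\<psi> a w))
        = transition B (a + s + s) (b + s) (\<phi> (a + s) (\<psi> a w))"
      using \<phi> \<psi> b w by (simp add: pers_hom_def linear_on_def)
    also have "\<dots> = transition B (a + 2 * s) (b + s) (transition B a (a + 2 * s) w)"
      using c[OF w] by (simp add: algebra_simps)
    also have "\<dots> = transition B a (b + s) w"
      using PM_D(4)[OF B _ _ w] s b by simp
    finally show ?thesis by simp
  qed
  with that[of \<phi> \<psi>] \<phi> \<psi> show ?thesis by (simp add: pers_hom_def)
qed

text \<open>
  An element of \<open>B\<close> has a shadow in \<open>A\<close>, and outlives it by at most the shift \<open>s\<close>.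
\<close>

lemma interleaved_dies:
  assumes A: "A \<in> PM" and B: "B \<in> PM" and int: "interleaved s A B" and w: "w \<in> space_at B a"
  obtains v where "v \<in> space_at A (a + s)"
    "\<And>b. a + s \<le> b \<Longrightarrow> transition A (a + s) b v = 0 \<Longrightarrow> transition B a (b + s) w = 0"
proof -
  obtain \<phi> \<psi> where
    \<phi>: "\<And>a. linear_on (space_at A a) (space_at B (a + s)) (\<phi> a)" and
    \<psi>: "\<And>a. linear_on (space_at B a) (space_at A (a + s)) (\<psi> a)" and
    c: "\<And>a b w. w \<in> space_at B a \<Longrightarrow> a + s \<le> b \<Longrightarrow>
       transition B a (b + s) w = \<phi> b (transition A (a + s) b (\<psi> a w))"
    using interleaved_factors[OF B int] by metis
  have "\<phi> b 0 = 0" for b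
    using linear_on_zero[OF \<phi> PM_D(6)[OF A]] .
  with c[OF w] \<psi> w that[of "\<psi> a w"] show ?thesis by (simp add: linear_on_def)
qed

lemma QTAME_interleaved_span:
  assumes A: "A \<in> QTAME" and B: "B \<in> PM" and int: "interleaved s A B" and ab: "a + 2 * s < b"
  shows "\<exists>C. finite C \<and> transition B a b ` space_at B a \<subseteq> fun_vs.span C"
proof -
  have APM: "A \<in> PM" using A by (simp add: QTAME_def)
  obtain \<phi> \<psi> where
    \<phi>: "\<And>a. linear_on (space_at A a) (space_at B (a + s)) (\<phi> a)" and
    \<psi>: "\<And>a. linear_on (space_at B a) (space_at A (a + s)) (\<psi> a)" and
    c: "\<And>a b w. w \<in> space_at B a \<Longrightarrow> a + s \<le> b \<Longrightarrow>
       transition B a (b + s) w = \<phi> b (transition A (a + s) b (\<psi> a w))"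
    using interleaved_factors[OF B int] by metis
  let ?t = "transition A (a + s) (b - s)"
  have "a + s < b - s" using ab by simp
  then have "finite_dimensional (?t ` space_at A (a + s))"
    using A unfolding QTAME_def by blast
  then obtain F where F: "finite F" "fun_vs.span F = ?t ` space_at A (a + s)"
    unfolding finite_dimensional_def by metis
  have tA: "?t ` space_at A (a + s) \<subseteq> space_at A (b - s)"
    by (rule image_subsetI, rule PM_D(5)[OF APM]) (use ab in simp_all)
  then have "F \<subseteq> space_at A (b - s)" using F(2) fun_vs.span_superset[of F] by simp
  then have "\<phi> (b - s) ` fun_vs.span F = fun_vs.span (\<phi> (b - s) ` F)"
    by (rule linear_on_image_span[OF \<phi> PM_D(1)[OF APM]])
  moreover have "transition B a b ` space_at B a \<subseteq> \<phi> (b - s) ` fun_vs.span F"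
  proof (rule image_subsetI)
    fix w assume w: "w \<in> space_at B a"
    then have "?t (\<psi> a w) \<in> fun_vs.span F" using \<psi> F(2) by (simp add: linear_on_def)
    moreover have "transition B a b w = \<phi> (b - s) (?t (\<psi> a w))"
      using c[OF w, of "b - s"] ab by simp
    ultimately show "transition B a b w \<in> \<phi> (b - s) ` fun_vs.span F" by simp
  qed
  ultimately have "transition B a b ` space_at B a \<subseteq> fun_vs.span (\<phi> (b - s) ` F)" by simp
  with finite_imageI[OF F(1)] show ?thesis by metis
qed

section \<open>Barcode modules\<close>

text \<open>
  These modules provide concrete models in which a coordinate \<open>x\<close> is alive exactly at the times in
  \<open>J x\<close>. Direct sums of interval modules arise when \<open>V\<close> consists of finitely supported functions, and
  products of interval modules when \<open>V\<close> consists of all functions supported in a given set.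
\<close>

definition barcode_module :: "('x \<Rightarrow> 'k::field) set \<Rightarrow> ('x \<Rightarrow> real set) \<Rightarrow> ('k, 'x) pers" where
  "barcode_module V J =
     \<lparr>space_at = (\<lambda>a. {f \<in> V. \<forall>x. f x \<noteq> 0 \<longrightarrow> a \<in> J x}),
      transition = (\<lambda>a b f x. if b \<in> J x then f x else 0)\<rparr>"

text \<open>
  This closure property makes the structure maps of a barcode module, which set dead coordinates to
  zero, stay inside \<open>V\<close>.
\<close>

definition truncatable :: "'x set \<Rightarrow> ('x \<Rightarrow> 'k::field) set \<Rightarrow> bool" where
  "truncatable X V \<longleftrightarrow> fun_vs.subspace V \<and> V \<subseteq> supported X \<and>
     (\<forall>f\<in>V. \<forall>S. (\<lambda>x. if x \<in> S then f x else 0) \<in> V)"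

lemma truncatable_supported: "truncatable X (supported X)"
  using subspace_supported[of X] by (auto simp: truncatable_def supported_def)

lemma truncatable_fin_supported: "truncatable X (fin_supported X)"
  using subspace_fin_supported[of X]
  by (auto simp: truncatable_def fin_supported_def supported_def
      elim: finite_subset[rotated])

lemma barcode_module_PM:
  assumes V: "truncatable X V" and J: "\<And>x. x \<in> X \<Longrightarrow> is_interval (J x)"
  shows "barcode_module V J \<in> PM"
proof -
  let ?M = "barcode_module V J"
  have sub: "fun_vs.subspace V" and VX: "V \<subseteq> supported X"
    and tr: "\<And>f S. f \<in> V \<Longrightarrow> (\<lambda>x. if x \<in> S then f x else 0) \<in> V"
    using V by (auto simp: truncatable_def)
  have "fun_vs.subspace (space_at ?M a)" for a
    using sub by (auto simp: fun_vs.subspace_def barcode_module_def fscale_def)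
      (metis add.right_neutral)
  moreover have "linear_on (space_at ?M a) (space_at ?M b) (transition ?M a b)" for a b
    using tr[of _ "{x. b \<in> J x}"]
    by (auto simp: linear_on_def barcode_module_def fun_eq_iff fscale_def)
  moreover have "transition ?M a a v = v" if "v \<in> space_at ?M a" for a v
    using that by (auto simp: barcode_module_def fun_eq_iff)
  moreover have "transition ?M b c (transition ?M a b v) = transition ?M a c v"
    if "a \<le> b" "b \<le> c" "v \<in> space_at ?M a" for a b c v
  proof
    fix x
    show "transition ?M b c (transition ?M a b v) x = transition ?M a c v x"
    proof (cases "v x = 0")
      case False
      then have v: "v \<in> V" "a \<in> J x" using that(3) by (simp_all add: barcode_module_def)
      have "x \<in> X" using subsetD[OF VX v(1)] False by (simp add: supported_def)
      then have "c \<in> J x \<Longrightarrow> b \<in> J x"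
        using mem_is_interval_1_I[OF J v(2)] that(1,2) by blast
      then show ?thesis by (auto simp: barcode_module_def)
    qed (auto simp: barcode_module_def)
  qed
  ultimately show ?thesis by (simp add: PM_def persistence_module_def)
qed

abbreviation interval_sum :: "'x set \<Rightarrow> ('x \<Rightarrow> real set) \<Rightarrow> ('k::field, 'x) pers" where
  "interval_sum X J \<equiv> barcode_module (fin_supported X) J"

lemma interval_sum_PM:
  "(\<And>x. x \<in> X \<Longrightarrow> is_interval (J x)) \<Longrightarrow> interval_sum X J \<in> PM"
  by (rule barcode_module_PM[OF truncatable_fin_supported])

lemma space_at_interval_sum:
  "space_at (interval_sum X J) a = fin_supported {x \<in> X. a \<in> J x}"
  by (auto simp: barcode_module_def fin_supported_def supported_def)

lemma space_at_interval_sum_span: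
  "space_at (interval_sum X J) a = fun_vs.span (unit_vec ` {x \<in> X. a \<in> J x})"
  unfolding space_at_interval_sum by (rule fin_supported_eq_span)

lemma interval_sum_iso_direct_sum:
  "isomorphic (interval_sum X J :: ('k::field, 'i) pers)
     (direct_sum X (\<lambda>i. interval_module (J i)))"
proof -
  let ?M = "interval_sum X J :: ('k, 'i) pers"
  let ?D = "direct_sum X (\<lambda>i. interval_module (J i) :: ('k, unit) pers)"
  define \<phi> :: "real \<Rightarrow> ('i \<Rightarrow> 'k) \<Rightarrow> ('i \<times> unit \<Rightarrow> 'k)" where "\<phi> = (\<lambda>a f (i, _). f i)"
  have D: "space_at ?D a =
      {f. (\<forall>i. f (i, ()) \<noteq> 0 \<longrightarrow> i \<in> X \<and> a \<in> J i) \<and> finite {i. f (i, ()) \<noteq> 0}}" for a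
    by (auto simp: direct_sum_def interval_module_def fun_eq_iff split: if_splits)
  have M: "space_at ?M a =
      {f. (\<forall>i. f i \<noteq> 0 \<longrightarrow> i \<in> X \<and> a \<in> J i) \<and> finite {i. f i \<noteq> 0}}" for a
    unfolding space_at_interval_sum by (auto simp: fin_supported_def supported_def)
  have "bij_betw (\<phi> a) (space_at ?M a) (space_at ?D a)" for a
    by (rule bij_betw_byWitness[where f' = "\<lambda>f i. f (i, ())"])
      (auto simp: \<phi>_def D M)
  moreover have "pers_hom 0 ?M ?D \<phi>"
    unfolding pers_hom_def linear_on_def
  proof (intro conjI allI ballI impI)
    fix a b v assume "v \<in> space_at ?M a"
    then have "\<forall>i. v i \<noteq> 0 \<longrightarrow> i \<in> X \<and> a \<in> J i" by (simp add: M)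
    then show "\<phi> b (transition ?M a b v) = transition ?D (a + 0) (b + 0) (\<phi> a v)"
      by (auto simp: \<phi>_def direct_sum_def interval_module_def barcode_module_def fun_eq_iff)
  qed (auto simp: \<phi>_def D M fscale_def fun_eq_iff)
  ultimately show ?thesis unfolding isomorphic_def by blast
qed

text \<open>
  This replaces an approximating module in a decomposable class by an explicit one.
\<close>

lemma interval_decomposition_interleaved:
  assumes "M \<in> PM" "interval_decomposition M A J" "interleaved s M B"
  shows "interleaved s (interval_sum A J) B"
proof -
  have "interval_sum A J \<in> PM"
    using assms(2) by (intro interval_sum_PM) (simp add: interval_decomposition_def)
  then have "isomorphic (direct_sum A (\<lambda>i. interval_module (J i))) (interval_sum A J)"
    by (rule isomorphic_sym[OF _ interval_sum_iso_direct_sum])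
  then have "isomorphic M (interval_sum A J)"
    using assms(2) isomorphic_trans by (auto simp: interval_decomposition_def)
  then show ?thesis by (rule interleaved_isomorphic[OF assms(1) _ assms(3)])
qed

text \<open>
  The classes demand index sets in a fixed type; the index may be moved there without losing
  finiteness or countability and without introducing new intervals.
\<close>

lemma interval_decomposition_reindexed:
  fixes M :: "('k::field, 'x) pers" and J :: "'i \<Rightarrow> real set"
  assumes J: "\<And>i. i \<in> X \<Longrightarrow> is_interval (J i) \<and> J i \<noteq> {}"
    and iso: "isomorphic M (interval_sum X J)"
  shows "\<exists>(A :: ('k, 'x) index set) J'. interval_decomposition M A J' \<and>
    (finite X \<longrightarrow> finite A) \<and> (countable X \<longrightarrow> countable A) \<and> J' ` A \<subseteq> J ` X"
proof -
  have "interval_decomposition M X J"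
    using J isomorphic_trans[OF iso interval_sum_iso_direct_sum]
    by (simp add: interval_decomposition_def)
  then obtain g :: "'i \<Rightarrow> ('k, 'x) index" where g: "inj_on g X"
    "interval_decomposition M (g ` X) (\<lambda>j. J (inv_into X g j))"
    using interval_decomposition_index by blast
  then have "(\<lambda>j. J (inv_into X g j)) ` g ` X \<subseteq> J ` X"
    by (auto simp: inv_into_f_f)
  with g(2) show ?thesis
    by (intro exI[of _ "g ` X"] exI[of _ "\<lambda>j. J (inv_into X g j)"]) simp
qed

lemma interval_sum_linear_image:
  assumes J: "\<And>i. i \<in> A \<Longrightarrow> is_interval (J i)"
    and f: "linear_on (space_at (interval_sum A J) a) W f"
  shows "f ` space_at (interval_sum A J) a
       = fun_vs.span ((\<lambda>i. f (unit_vec i)) ` {i \<in> A. a \<in> J i})"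
proof -
  let ?U = "unit_vec ` {i \<in> A. a \<in> J i}"
  have "?U \<subseteq> space_at (interval_sum A J) a"
    by (auto simp: space_at_interval_sum unit_vec_in_fin_supported)
  moreover have "interval_sum A J \<in> PM" using J by (rule interval_sum_PM)
  ultimately have "f ` fun_vs.span ?U = fun_vs.span (f ` ?U)"
    using linear_on_image_span[OF f PM_D(1)] by blast
  then show ?thesis by (simp only: space_at_interval_sum_span image_image)
qed

text \<open>
  A structure map of \<open>B\<close> that factors through a sum of intervals has an image spanned by the
  images of the generators, at most one for each summand. For finite or countable \<open>A\<close> this bounds the
  rank.
\<close>

lemma interval_sum_interleaved_span:
  fixes J :: "'i \<Rightarrow> real set" and B :: "('k::field, 'x) pers"
  assumes J: "\<And>i. i \<in> A \<Longrightarrow> is_interval (J i)" and B: "B \<in> PM"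
    and int: "interleaved s (interval_sum A J) B" and b: "a + 2 * s \<le> b"
  obtains h :: "'i \<Rightarrow> 'x \<Rightarrow> 'k" where "transition B a b ` space_at B a \<subseteq> fun_vs.span (h ` A)"
proof -
  let ?D = "interval_sum A J :: ('k, 'i) pers"
  have D: "?D \<in> PM" using J by (rule interval_sum_PM)
  obtain \<phi> \<psi> where
    \<phi>: "\<And>a. linear_on (space_at ?D a) (space_at B (a + s)) (\<phi> a)" and
    \<psi>: "\<And>a. linear_on (space_at B a) (space_at ?D (a + s)) (\<psi> a)" and
    c: "\<And>a b w. w \<in> space_at B a \<Longrightarrow> a + s \<le> b \<Longrightarrow>
       transition B a (b + s) w = \<phi> b (transition ?D (a + s) b (\<psi> a w))"
    using interleaved_factors[OF B int] by metis
  let ?h = "\<lambda>i. \<phi> (b - s) (unit_vec i)"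
  have "transition B a b w \<in> fun_vs.span (?h ` A)" if w: "w \<in> space_at B a" for w
  proof -
    have "\<psi> a w \<in> space_at ?D (a + s)" using \<psi> w by (simp add: linear_on_def)
    then have "transition ?D (a + s) (b - s) (\<psi> a w) \<in> space_at ?D (b - s)"
      using b by (intro PM_D(5)[OF D]) simp_all
    moreover have "transition B a b w = \<phi> (b - s) (transition ?D (a + s) (b - s) (\<psi> a w))"
      using c[OF w, of "b - s"] b by simp
    ultimately have "transition B a b w \<in> \<phi> (b - s) ` space_at ?D (b - s)" by simp
    also have "\<dots> = fun_vs.span (?h ` {i \<in> A. b - s \<in> J i})"
        using interval_sum_linear_image[OF _ \<phi>] J by simp
    also have "\<dots> \<subseteq> fun_vs.span (?h ` A)" by (intro fun_vs.span_mono) auto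
    finally show ?thesis .
  qed
  then show ?thesis using that[of ?h] by (simp add: image_subset_iff)
qed

text \<open>
  A basis of \<open>V\<close> splits the constant module into copies of the line.
\<close>

lemma constant_module_decomposition:
  fixes V :: "('x \<Rightarrow> 'k::field) set"
  assumes V: "fun_vs.subspace V"
  obtains S :: "('x \<Rightarrow> 'k) set"
    where "isomorphic (barcode_module V (\<lambda>_. UNIV)) (interval_sum S (\<lambda>_. UNIV))"
proof -
  obtain S where S: "S \<subseteq> V" "fun_vs.independent S" "V \<subseteq> fun_vs.span S"
    using fun_vs.maximal_independent_subset by metis
  have VS: "V = fun_vs.span S" using S fun_vs.span_minimal[OF S(1) V] by simp
  let ?R = "fun_vs.representation S"
  let ?M = "barcode_module V (\<lambda>_. UNIV)"
    and ?D = "interval_sum S (\<lambda>_. UNIV) :: ('k, 'x \<Rightarrow> 'k) pers"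
  have M: "space_at ?M a = V" for a by (simp add: barcode_module_def)
  have D: "space_at ?D a = fin_supported S" for a by (simp add: space_at_interval_sum)
  have Rin: "?R v \<in> fin_supported S" for v
    using fun_vs.finite_representation[of S v] fun_vs.representation_ne_zero[of S v]
    by (auto simp: fin_supported_def supported_def)
  have comb: "(\<Sum>v\<in>{v. c v \<noteq> 0}. fscale (c v) v) \<in> V \<and> ?R (\<Sum>v\<in>{v. c v \<noteq> 0}. fscale (c v) v) = c"
    if c: "c \<in> fin_supported S" for c
  proof -
    have "(\<Sum>v\<in>{v. c v \<noteq> 0}. fscale (c v) v) \<in> V"
      using c S(1) V by (auto simp: fin_supported_def supported_def
          intro!: fun_vs.subspace_sum fun_vs.subspace_scale)
    moreover from this have "?R (\<Sum>v\<in>{v. c v \<noteq> 0}. fscale (c v) v) = c"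
      using c VS by (intro fun_vs.representation_eqI[OF S(2)])
        (auto simp: fin_supported_def supported_def)
    ultimately show ?thesis by simp
  qed
  have "bij_betw ?R V (fin_supported S)"
    using fun_vs.sum_nonzero_representation_eq[OF S(2)] VS comb Rin
    by (intro bij_betw_byWitness[where f' = "\<lambda>c. \<Sum>v\<in>{v. c v \<noteq> 0}. fscale (c v) v"]) auto
  moreover have "pers_hom 0 ?M ?D (\<lambda>a. ?R)"
    unfolding pers_hom_def linear_on_def M D
    using Rin fun_vs.representation_add[OF S(2)] fun_vs.representation_scale[OF S(2)] VS
    by (auto simp: barcode_module_def fscale_def fun_eq_iff)
  ultimately have "isomorphic ?M ?D"
    unfolding isomorphic_def M D by blast
  then show ?thesis by (rule that)
qed

section \<open>Membership in the classes\<close>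

lemma interval_sum_index:
  fixes J :: "'x \<Rightarrow> real set"
  assumes J: "\<And>x. x \<in> X \<Longrightarrow> is_interval (J x) \<and> J x \<noteq> {}"
  shows "\<exists>(A :: ('k::field, 'x) index set) J'.
    interval_decomposition (interval_sum X J :: ('k, 'x) pers) A J' \<and>
    (finite X \<longrightarrow> finite A) \<and> (countable X \<longrightarrow> countable A) \<and> J' ` A \<subseteq> J ` X"
proof -
  have "isomorphic (interval_sum X J :: ('k, 'x) pers) (interval_sum X J)"
    unfolding isomorphic_def pers_hom_def linear_on_def
    using PM_D(5)[OF interval_sum_PM] J
    by (intro exI[of _ "\<lambda>a v. v"]) (auto simp: bij_betw_def)
  with J show ?thesis by (rule interval_decomposition_reindexed)
qed

lemma interval_sum_classes:
  fixes J :: "'x \<Rightarrow> real set"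
  assumes J: "\<And>x. x \<in> X \<Longrightarrow> is_interval (J x) \<and> J x \<noteq> {}"
  defines "M \<equiv> interval_sum X J :: ('k::field, 'x) pers"
  shows "M \<in> ID" and "countable X \<Longrightarrow> M \<in> CID" and "finite X \<Longrightarrow> M \<in> FID"
    and "countable X \<Longrightarrow> (\<And>x. x \<in> X \<Longrightarrow> bounded (J x)) \<Longrightarrow> M \<in> CFID"
    and "finite X \<Longrightarrow> (\<And>x. x \<in> X \<Longrightarrow> bounded (J x)) \<Longrightarrow> M \<in> FFID"
    and "finite X \<Longrightarrow> (\<And>x. x \<in> X \<Longrightarrow> J x \<subseteq> {c..d}) \<Longrightarrow> M \<in> FFID_in c d"
proof -
  have "\<exists>(A :: ('k, 'x) index set) J'. interval_decomposition M A J' \<and>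
      (finite X \<longrightarrow> finite A) \<and> (countable X \<longrightarrow> countable A) \<and> J' ` A \<subseteq> J ` X"
    unfolding M_def using J by (rule interval_sum_index)
  then obtain A :: "('k, 'x) index set" and J' where A: "interval_decomposition M A J'"
    "finite X \<longrightarrow> finite A" "countable X \<longrightarrow> countable A" "J' ` A \<subseteq> J ` X"
    by (elim exE conjE)
  have J': "\<exists>x\<in>X. J' i = J x" if "i \<in> A" for i using A(4) that by blast
  have M: "M \<in> PM" using J interval_sum_PM[of X J] by (simp add: M_def)
  show "M \<in> ID"
    using M A(1) unfolding ID_def by (intro CollectI conjI exI[of _ A] exI[of _ J'])
  show "M \<in> CID" if "countable X"
    using M A(1,3) that unfolding CID_def
    by (intro CollectI conjI exI[of _ A] exI[of _ J']) simp_all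
  show "M \<in> FID" if "finite X"
    using M A(1,2) that unfolding FID_def
    by (intro CollectI conjI exI[of _ A] exI[of _ J']) simp_all
  show "M \<in> CFID" if "countable X" "\<And>x. x \<in> X \<Longrightarrow> bounded (J x)"
  proof -
    have "\<forall>i\<in>A. bounded (J' i)" using J' that(2) by metis
    then show ?thesis using M A(1,3) that(1)
      unfolding CFID_def by (intro CollectI conjI exI[of _ A] exI[of _ J']) simp_all
  qed
  show "M \<in> FFID" if "finite X" "\<And>x. x \<in> X \<Longrightarrow> bounded (J x)"
  proof -
    have "\<forall>i\<in>A. bounded (J' i)" using J' that(2) by metis
    then show ?thesis using M A(1,2) that(1)
      unfolding FFID_def by (intro CollectI conjI exI[of _ A] exI[of _ J']) simp_all
  qed
  show "M \<in> FFID_in c d" if "finite X" "\<And>x. x \<in> X \<Longrightarrow> J x \<subseteq> {c..d}"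
  proof -
    have "\<forall>i\<in>A. bounded (J' i) \<and> J' i \<subseteq> {c..d}"
      using J' that(2) bounded_subset[OF bounded_closed_interval] by metis
    then show ?thesis using M A(1,2) that(1)
      unfolding FFID_in_def by (intro CollectI conjI exI[of _ A] exI[of _ J']) simp_all
  qed
qed

lemma constant_module_ID:
  assumes V: "truncatable X (V :: ('x \<Rightarrow> 'k::field) set)"
  shows "barcode_module V (\<lambda>_. UNIV) \<in> ID"
proof -
  let ?M = "barcode_module V (\<lambda>_. UNIV)"
  obtain S :: "('x \<Rightarrow> 'k) set" where S: "isomorphic ?M (interval_sum S (\<lambda>_. UNIV))"
    using constant_module_decomposition V unfolding truncatable_def by metis
  obtain A :: "('k, 'x) index set" and J' where "interval_decomposition ?M A J'"
    using interval_decomposition_reindexed[OF _ S] by (metis UNIV_not_empty is_interval_univ)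
  moreover have "?M \<in> PM" using V by (rule barcode_module_PM) (simp add: is_interval_univ)
  ultimately show ?thesis unfolding ID_def by (intro CollectI conjI exI[of _ A] exI[of _ J'])
qed

lemma PFD_subset_QTAME: "PFD \<subseteq> QTAME"
proof
  fix M :: "('k::field, 'x) pers" assume "M \<in> PFD"
  then have M: "M \<in> PM" "\<And>a. finite_dimensional (space_at M a)" by (auto simp: PFD_def)
  have "finite_dimensional (transition M a b ` space_at M a)" if "a < b" for a b
    using finite_dimensional_image[OF PM_D(2,1)[OF M(1)] M(2)] that by simp
  with M(1) show "M \<in> QTAME" by (simp add: QTAME_def)
qed

lemma interval_sum_PFD:
  assumes J: "\<And>x. x \<in> X \<Longrightarrow> is_interval (J x)" and fin: "\<And>a. finite {x \<in> X. a \<in> J x}"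
  shows "(interval_sum X J :: ('k::field, 'x) pers) \<in> PFD"
proof -
  have "finite_dimensional (space_at (interval_sum X J :: ('k, 'x) pers) a)" for a
    unfolding finite_dimensional_def space_at_interval_sum_span
    by (intro exI[of _ "unit_vec ` {x \<in> X. a \<in> J x}"]) (simp add: fin)
  then show ?thesis using interval_sum_PM[of X J] J by (auto simp: PFD_def)
qed

lemma FFID_subset_CFID: "FFID \<subseteq> CFID"
  unfolding FFID_def CFID_def by (intro Collect_mono) (metis countable_finite)

lemma FFID_subset_FID: "FFID \<subseteq> FID"
  unfolding FFID_def FID_def by (intro Collect_mono) metis

lemma ZERO_subset_EPH: "ZERO \<subseteq> EPH"
proof
  fix M :: "('k::field, 'x) pers" assume "M \<in> ZERO"
  then have M: "M \<in> PM" "\<And>a. space_at M a = {0}" by (auto simp: ZERO_def)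
  have "transition M a b v = 0" if "a < b" "v \<in> space_at M a" for a b v
    using PM_D(5)[OF M(1), of a b v] that M(2) by simp
  with M(1) show "M \<in> EPH" by (simp add: EPH_def)
qed

lemma FFID_bounded:
  assumes "M \<in> FFID"
  obtains c d where "c < d" "M \<in> FFID_in c d"
proof -
  obtain A :: "('a, 'b) index set" and J where M: "M \<in> PM" "interval_decomposition M A J" "finite A"
    "\<forall>i\<in>A. bounded (J i)"
    using assms unfolding FFID_def mem_Collect_eq by metis
  have "bounded (\<Union>i\<in>A. J i)" using M(3,4) by (simp add: bounded_UN)
  then obtain k where k: "0 < k" "\<And>t. t \<in> (\<Union>i\<in>A. J i) \<Longrightarrow> norm t \<le> k"
    unfolding bounded_pos by metis
  have "\<forall>i\<in>A. bounded (J i) \<and> J i \<subseteq> {-k..k}"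
    using M(4) k(2) by (force simp: abs_le_iff)
  with M have "M \<in> FFID_in (-k) k"
    unfolding FFID_in_def by (intro CollectI conjI exI[of _ A] exI[of _ J])
  with k(1) show ?thesis by (intro that[of "-k" k]) auto
qed

lemma interval_decomposition_transition_zero:
  assumes M: "M \<in> PM" and dec: "interval_decomposition M A J"
    and ab: "a \<le> b" and v: "v \<in> space_at M a"
    and J: "\<And>i. i \<in> A \<Longrightarrow> a \<in> J i \<Longrightarrow> b \<notin> J i"
  shows "transition M a b v = 0"
proof -
  let ?D = "direct_sum A (\<lambda>i. interval_module (J i))"
  have "isomorphic M ?D" using dec by (simp add: interval_decomposition_def)
  then obtain f where f: "pers_hom 0 M ?D f"
    "\<And>a. bij_betw (f a) (space_at M a) (space_at ?D a)"
    unfolding isomorphic_def by blast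
  have "f b (transition M a b v) = transition ?D a b (f a v)"
    using f(1) ab v by (simp add: pers_hom_def)
  also have "\<dots> = 0"
    using J by (auto simp: direct_sum_def interval_module_def fun_eq_iff)
  also have "\<dots> = f b 0"
    using f(1) PM_D(6)[OF M] by (intro linear_on_zero[symmetric]) (auto simp: pers_hom_def)
  finally show ?thesis
    using PM_D(5)[OF M ab v] PM_D(6)[OF M] by (rule inj_onD[OF bij_betw_imp_inj_on[OF f(2)]])
qed

lemma FFID_in_transition_zero:
  assumes "M \<in> FFID_in c d" "d - c < b - a" "a \<le> b" "v \<in> space_at M a"
  shows "transition M a b v = 0"
proof -
  obtain A :: "('a, 'b) index set" and J where M: "M \<in> PM" "interval_decomposition M A J"
    "\<forall>i\<in>A. J i \<subseteq> {c..d}"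
    using assms(1) unfolding FFID_in_def mem_Collect_eq by metis
  show ?thesis
  proof (rule interval_decomposition_transition_zero[OF M(1,2) assms(3,4)])
    fix i assume "i \<in> A" "a \<in> J i"
    then have "J i \<subseteq> {c..d}" "a \<in> {c..d}" using M(3) by blast+
    then show "b \<notin> J i" using assms(2) by (auto dest!: subsetD[of "J i" _ b])
  qed
qed

text \<open>
  An element has only finitely many nonzero components, each in a bounded interval.
\<close>

lemma CFID_element_dies:
  assumes "M \<in> CFID" "v \<in> space_at M a"
  obtains b where "a \<le> b" "transition M a b v = 0"
proof -
  obtain A :: "('a, 'b) index set" and J where M: "M \<in> PM" "interval_decomposition M A J"
    "\<forall>i\<in>A. bounded (J i)"
    using assms(1) unfolding CFID_def mem_Collect_eq by metis
  let ?D = "direct_sum A (\<lambda>i. interval_module (J i)) :: ('a, ('a, 'b) index \<times> unit) pers"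
  have "isomorphic M ?D" using M(2) by (simp add: interval_decomposition_def)
  then obtain f where f: "pers_hom 0 M ?D f"
    "\<And>a. bij_betw (f a) (space_at M a) (space_at ?D a)"
    unfolding isomorphic_def by blast
  let ?w = "f a v"
  have w: "?w \<in> space_at ?D a" using bij_betwE[OF f(2)] assms(2) by blast
  define I where "I = {i. (\<lambda>x. ?w (i, x)) \<noteq> 0}"
  have I: "finite I" "I \<subseteq> A" using w by (auto simp: I_def direct_sum_def)
  have "bounded (\<Union>i\<in>I. J i)" using I M(3) by (auto intro: bounded_UN)
  then obtain k where k: "\<And>t. t \<in> (\<Union>i\<in>I. J i) \<Longrightarrow> norm t \<le> k"
    unfolding bounded_iff by metis
  define b where "b = max a (\<bar>k\<bar> + 1)"
  have ab: "a \<le> b" by (simp add: b_def)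
  have b: "b \<notin> J i" if "i \<in> I" for i
  proof
    assume "b \<in> J i"
    then have "norm b \<le> k" using k that by blast
    then show False by (simp add: b_def max_def split: if_splits)
  qed
  have "f b (transition M a b v) = transition ?D a b ?w"
    using f(1) assms(2) by (simp add: pers_hom_def b_def)
  also have "\<dots> = 0"
  proof
    fix z :: "('a, 'b) index \<times> unit"
    obtain i where z: "z = (i, ())" by (cases z) auto
    show "transition ?D a b ?w z = 0 z"
    proof (cases "i \<in> I")
      case True
      then show ?thesis using b[OF True] by (simp add: z direct_sum_def interval_module_def)
    next
      case False
      then have "(\<lambda>x. ?w (i, x)) = 0" by (simp add: I_def)
      then show ?thesis by (simp add: z direct_sum_def interval_module_def)
    qed
  qed
  also have "\<dots> = f b 0"
    using f(1) PM_D(6)[OF M(1)] by (intro linear_on_zero[symmetric]) (auto simp: pers_hom_def)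
  finally have "transition M a b v = 0"
    using PM_D(5)[OF M(1) ab assms(2)] PM_D(6)[OF M(1)]
    by (rule inj_onD[OF bij_betw_imp_inj_on[OF f(2)]])
  with ab show ?thesis by (rule that)
qed

section \<open>Modules far from a class\<close>

text \<open>
  The generator of the interval, born by time \<open>p\<close>, would have a shadow in \<open>A\<close> that dies while the
  generator is still alive.
\<close>

lemma not_interleaved_interval:
  fixes A :: "('k::field, 'y) pers" and x :: 'x
  assumes A: "A \<in> PM" and J: "is_interval J" "p \<in> J"
    and dies: "\<And>v. v \<in> space_at A (p + s) \<Longrightarrow>
      \<exists>b\<ge>p + s. b + s \<in> J \<and> transition A (p + s) b v = 0"
  shows "\<not> interleaved s A (interval_sum {x} (\<lambda>_. J))"
proof
  let ?B = "interval_sum {x} (\<lambda>_. J) :: ('k, 'x) pers"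
  assume int: "interleaved s A ?B"
  have B: "?B \<in> PM" using J(1) by (intro interval_sum_PM)
  have e: "unit_vec x \<in> space_at ?B p"
    using J(2) by (auto simp: space_at_interval_sum intro: unit_vec_in_fin_supported)
  obtain v where v: "v \<in> space_at A (p + s)"
    "\<And>b. p + s \<le> b \<Longrightarrow> transition A (p + s) b v = 0 \<Longrightarrow> transition ?B p (b + s) (unit_vec x) = 0"
    using interleaved_dies[OF A B int e] by metis
  obtain b where b: "p + s \<le> b" "b + s \<in> J" "transition A (p + s) b v = 0"
    using dies[OF v(1)] by blast
  have "transition ?B p (b + s) (unit_vec x) x = 1"
    using b(2) by (simp add: barcode_module_def unit_vec_def)
  then show False using v(2)[OF b(1,3)] by simp
qed

lemma not_interleaved_long_interval:
  assumes A: "A \<in> PM" and "0 \<le> s" "0 \<le> \<delta>" "p + 2 * s + \<delta> \<le> q"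
    and dies: "\<And>a b v. b = a + \<delta> \<Longrightarrow> v \<in> space_at A a \<Longrightarrow> transition A a b v = 0"
  shows "\<not> interleaved s A (interval_sum {x} (\<lambda>_. {p..q}))"
proof (rule not_interleaved_interval[OF A, where p = p])
  fix v assume "v \<in> space_at A (p + s)"
  then show "\<exists>b\<ge>p + s. b + s \<in> {p..q} \<and> transition A (p + s) b v = 0"
    using assms(2-4) dies[OF refl] by (intro exI[of _ "p + s + \<delta>"]) simp
qed (use assms in \<open>auto simp: is_interval_cc\<close>)

lemma CFID_not_interleaved_line:
  assumes "A \<in> CFID"
  shows "\<not> interleaved s A (interval_sum {x} (\<lambda>_. UNIV))"
proof (rule not_interleaved_interval[where p = 0])
  show "A \<in> PM" using assms by (simp add: CFID_def)
  fix v assume "v \<in> space_at A (0 + s)"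
  then show "\<exists>b\<ge>0 + s. b + s \<in> UNIV \<and> transition A (0 + s) b v = 0"
    using CFID_element_dies[OF assms] by (metis UNIV_I)
qed auto

lemma EPH_not_interleaved_line:
  assumes "A \<in> EPH"
  shows "\<not> interleaved s A (interval_sum {x} (\<lambda>_. UNIV))"
proof (rule not_interleaved_interval[where p = 0])
  show "A \<in> PM" using assms by (simp add: EPH_def)
  fix v assume "v \<in> space_at A (0 + s)"
  then show "\<exists>b\<ge>0 + s. b + s \<in> UNIV \<and> transition A (0 + s) b v = 0"
    using assms by (intro exI[of _ "0 + s + 1"]) (simp add: EPH_def)
qed auto

lemma EPH_not_interleaved_long_interval:
  assumes "A \<in> EPH" "0 \<le> s" "2 * s < q - p"
  shows "\<not> interleaved s A (interval_sum {x} (\<lambda>_. {p..q}))"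
  by (rule not_interleaved_long_interval[where \<delta> = "q - p - 2 * s"])
    (use assms in \<open>auto simp: EPH_def\<close>)

lemma FFID_in_not_interleaved_long_interval:
  assumes "A \<in> FFID_in c d" "c < d" "0 \<le> s" "2 * s + (d - c) < q - p"
  shows "\<not> interleaved s A (interval_sum {x} (\<lambda>_. {p..q}))"
proof (rule not_interleaved_long_interval[where \<delta> = "q - p - 2 * s"])
  show "A \<in> PM" using assms(1) by (simp add: FFID_in_def)
  show "transition A a b v = 0" if "b = a + (q - p - 2 * s)" "v \<in> space_at A a" for a b v
    using assms(2,4) that by (intro FFID_in_transition_zero[OF assms(1)]) simp_all
qed (use assms in auto)

definition nested_intervals :: "(nat \<Rightarrow> 'x) \<Rightarrow> ('k::field, 'x) pers" where
  "nested_intervals g = interval_sum (range g) (\<lambda>x. {0..real (inv g x)})"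

definition staircase :: "(nat \<Rightarrow> 'x) \<Rightarrow> ('k::field, 'x) pers" where
  "staircase g = interval_sum (range g) (\<lambda>x. {real (inv g x)..})"

definition constant_sequences :: "(nat \<Rightarrow> 'x) \<Rightarrow> ('k::field, 'x) pers" where
  "constant_sequences g = barcode_module (supported (range g)) (\<lambda>_. UNIV)"

text \<open>
  At time \<open>a\<close> this is the space of sequences vanishing at all positions below \<open>- a\<close>, and the structure
  maps are inclusions; from time \<open>0\<close> on it contains all sequences. It is the product of the interval
  modules of \<open>{-n..}\<close>.
\<close>

definition filtered_sequences :: "(nat \<Rightarrow> 'x) \<Rightarrow> ('k::field, 'x) pers" where
  "filtered_sequences g = barcode_module (supported (range g)) (\<lambda>x. {- real (inv g x)..})"

lemma nested_intervals_classes: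
  fixes g :: "nat \<Rightarrow> 'x"
  defines "M \<equiv> nested_intervals g :: ('k::field, 'x) pers"
  shows "M \<in> CFID" "M \<in> CID" "M \<in> ID" "M \<in> PM"
proof -
  show "M \<in> CFID" "M \<in> CID" "M \<in> ID"
    unfolding M_def nested_intervals_def
    by (rule interval_sum_classes; simp add: is_interval_cc)+
  then show "M \<in> PM" by (simp add: ID_def)
qed

lemma staircase_PFD:
  assumes g: "inj g"
  shows "(staircase g :: ('k::field, 'x) pers) \<in> PFD"
  unfolding staircase_def
proof (rule interval_sum_PFD)
  fix a :: real
  have "{x \<in> range g. a \<in> {real (inv g x)..}} \<subseteq> g ` {..nat \<lfloor>a\<rfloor>}"
    using g by (auto simp: le_nat_floor)
  then show "finite {x \<in> range g. a \<in> {real (inv g x)..}}" by (rule finite_subset) simp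
qed (simp add: is_interval_ci)

lemma constant_sequences_ID: "(constant_sequences g :: ('k::field, 'x) pers) \<in> ID"
  unfolding constant_sequences_def
  by (rule constant_module_ID[OF truncatable_supported])

lemma filtered_sequences_PM: "(filtered_sequences g :: ('k::field, 'x) pers) \<in> PM"
  unfolding filtered_sequences_def
  by (rule barcode_module_PM[OF truncatable_supported]) (simp add: is_interval_ci)

lemma nested_intervals_infinite_rank:
  fixes C :: "('x \<Rightarrow> 'k::field) set"
  assumes g: "inj g" and b: "0 \<le> b" and C: "finite C"
  shows "\<not> transition (nested_intervals g) 0 b ` space_at (nested_intervals g) 0 \<subseteq> fun_vs.span C"
proof
  let ?M = "nested_intervals g :: ('k, 'x) pers"
  assume sub: "transition ?M 0 b ` space_at ?M 0 \<subseteq> fun_vs.span C"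
  have "unit_vec (g n) \<in> fun_vs.span C" if n: "nat \<lceil>b\<rceil> \<le> n" for n
  proof -
    have "unit_vec (g n) \<in> space_at ?M 0"
      unfolding nested_intervals_def space_at_interval_sum
      by (rule unit_vec_in_fin_supported) (simp add: g)
    moreover have "transition ?M 0 b (unit_vec (g n)) = unit_vec (g n)"
      using n g b by (auto simp: nested_intervals_def barcode_module_def unit_vec_def fun_eq_iff)
    ultimately show ?thesis using sub by (metis image_subset_iff)
  qed
  then have "unit_vec ` g ` {nat \<lceil>b\<rceil>..} \<subseteq> fun_vs.span C" by auto
  then have "finite (g ` {nat \<lceil>b\<rceil>..})" by (rule card_le_of_unit_vecs_in_span(1)[OF C])
  then have "finite {nat \<lceil>b\<rceil>..}" using g by (rule finite_imageD[OF _ inj_on_subset]) simp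
  then show False by (simp add: infinite_Ici)
qed

lemma QTAME_not_interleaved_nested:
  fixes A :: "('k::field, 'y) pers" and g :: "nat \<Rightarrow> 'x"
  assumes "A \<in> QTAME" "inj g"
  shows "\<not> interleaved s A (nested_intervals g)"
proof
  let ?B = "nested_intervals g :: ('k, 'x) pers"
  assume int: "interleaved s A ?B"
  then have "0 \<le> s" by (simp add: interleaved_def)
  then have "0 \<le> 2 * s + 1" by simp
  moreover have "?B \<in> PM" by (rule nested_intervals_classes)
  ultimately show False
    using QTAME_interleaved_span[OF assms(1) _ int, of 0 "2 * s + 1"]
      nested_intervals_infinite_rank[OF assms(2)] by auto
qed

text \<open>
  The bound \<open>N\<close>, the number of summands of \<open>A\<close>, is chosen before \<open>a\<close> and \<open>b\<close>: ranks of \<open>B\<close> are bounded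
  uniformly in time.
\<close>

lemma FID_interleaved_span:
  fixes A :: "('k::field, 'y) pers" and B :: "('k, 'x) pers"
  assumes A: "A \<in> FID" and B: "B \<in> PM" and int: "interleaved s A B"
  obtains N where "\<And>a b. a + 2 * s \<le> b \<Longrightarrow>
    \<exists>C. finite C \<and> card C \<le> N \<and> transition B a b ` space_at B a \<subseteq> fun_vs.span C"
proof -
  obtain I :: "('k, 'y) index set" and J where I: "A \<in> PM" "interval_decomposition A I J" "finite I"
    using A unfolding FID_def mem_Collect_eq by metis
  have int': "interleaved s (interval_sum I J) B"
    using interval_decomposition_interleaved[OF I(1,2) int] .
  have J: "\<And>i. i \<in> I \<Longrightarrow> is_interval (J i)" using I(2) by (simp add: interval_decomposition_def)
  show ?thesis
  proof (rule that[of "card I"])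
    fix a b assume "a + 2 * s \<le> b"
    then obtain h :: "('k, 'y) index \<Rightarrow> 'x \<Rightarrow> 'k"
      where h: "transition B a b ` space_at B a \<subseteq> fun_vs.span (h ` I)"
      using interval_sum_interleaved_span[OF J B int'] by metis
    then show "\<exists>C. finite C \<and> card C \<le> card I \<and> transition B a b ` space_at B a \<subseteq> fun_vs.span C"
      using I(3) by (intro exI[of _ "h ` I"]) (simp add: card_image_le)
  qed
qed

lemma FID_not_interleaved_nested:
  fixes A :: "('k::field, 'y) pers" and g :: "nat \<Rightarrow> 'x"
  assumes "A \<in> FID" "inj g"
  shows "\<not> interleaved s A (nested_intervals g)"
proof
  let ?B = "nested_intervals g :: ('k, 'x) pers"
  assume int: "interleaved s A ?B"
  have B: "?B \<in> PM" by (rule nested_intervals_classes)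
  have s: "0 \<le> 2 * s" using int by (simp add: interleaved_def)
  show False
    using FID_interleaved_span[OF assms(1) B int] nested_intervals_infinite_rank[OF assms(2) s]
    by (metis add_0 order_refl)
qed

lemma FID_not_interleaved_staircase:
  fixes A :: "('k::field, 'y) pers" and g :: "nat \<Rightarrow> 'x"
  assumes A: "A \<in> FID" and g: "inj g"
  shows "\<not> interleaved s A (staircase g)"
proof
  let ?B = "staircase g :: ('k, 'x) pers"
  assume int: "interleaved s A ?B"
  have B: "?B \<in> PM" using staircase_PFD[where ?'k = 'k, OF g] by (simp add: PFD_def)
  have s: "0 \<le> s" using int by (simp add: interleaved_def)
  obtain N where N: "\<And>a b. a + 2 * s \<le> b \<Longrightarrow>
    \<exists>C. finite C \<and> card C \<le> N \<and> transition ?B a b ` space_at ?B a \<subseteq> fun_vs.span C"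
    using FID_interleaved_span[OF A B int] by metis
  \<comment> \<open>At time \<open>N\<close> the \<open>N + 1\<close> coordinates \<open>g 0, \<dots>, g N\<close> are alive, one more than the rank allows.\<close>
  let ?a = "real N" and ?b = "real N + 2 * s"
  obtain C where C: "finite C" "card C \<le> N"
    "transition ?B ?a ?b ` space_at ?B ?a \<subseteq> fun_vs.span C"
    using N[of ?a ?b] by auto
  have "unit_vec (g n) \<in> fun_vs.span C" if n: "n \<le> N" for n
  proof -
    have "unit_vec (g n) \<in> space_at ?B ?a"
      unfolding staircase_def space_at_interval_sum
      by (rule unit_vec_in_fin_supported) (simp add: g n)
    moreover have "transition ?B ?a ?b (unit_vec (g n)) = unit_vec (g n)"
      using n g s by (auto simp: staircase_def barcode_module_def unit_vec_def fun_eq_iff)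
    ultimately show ?thesis using C(3) by (metis image_subset_iff)
  qed
  then have "unit_vec ` g ` {..N} \<subseteq> fun_vs.span C" by auto
  then have "card (g ` {..N}) \<le> card C" by (rule card_le_of_unit_vecs_in_span(2)[OF C(1)])
  moreover have "card (g ` {..N}) = N + 1"
    using g by (simp add: card_image inj_on_subset)
  ultimately show False using C(2) by simp
qed

lemma CID_not_interleaved_constant_sequences:
  fixes A :: "('k::field, 'y) pers" and g :: "nat \<Rightarrow> 'x"
  assumes A: "A \<in> CID" and g: "inj g"
  shows "\<not> interleaved s A (constant_sequences g)"
proof
  let ?B = "constant_sequences g :: ('k, 'x) pers"
  assume int: "interleaved s A ?B"
  have B: "?B \<in> PM" using constant_sequences_ID[where ?'k = 'k, of g] by (simp add: ID_def)
  obtain I :: "('k, 'y) index set" and J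
    where I: "A \<in> PM" "interval_decomposition A I J" "countable I"
    using A unfolding CID_def mem_Collect_eq by metis
  have int': "interleaved s (interval_sum I J) ?B"
    using interval_decomposition_interleaved[OF I(1,2) int] .
  have J: "\<And>i. i \<in> I \<Longrightarrow> is_interval (J i)" using I(2) by (simp add: interval_decomposition_def)
  obtain h :: "('k, 'y) index \<Rightarrow> 'x \<Rightarrow> 'k"
    where "transition ?B 0 (2 * s) ` space_at ?B 0 \<subseteq> fun_vs.span (h ` I)"
    using interval_sum_interleaved_span[OF J B int', of 0 "2 * s"] by auto
  then have "supported (range g) \<subseteq> fun_vs.span (h ` I)"
    by (simp add: constant_sequences_def barcode_module_def)
  then show False
    using supported_not_countably_spanned[OF g countable_image[OF I(3)]] by blast
qed

text \<open>
  At times from \<open>0\<close> on, every sequence \<open>f\<close> equals \<open>\<phi> s (\<psi> 0 f)\<close>, so the images \<open>x i\<close> under \<open>\<phi> s\<close>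
  of the generators alive at time \<open>s\<close> span the space of all sequences. Only countably many of them
  are nonzero, which is impossible. Suppose that \<open>x i\<close> is nonzero.
  \<^item> The interval \<open>J i\<close> is unbounded above, because the structure maps of the filtered module are
    injective, so that \<open>\<phi>\<close> annihilates whatever dies.
  \<^item> It is bounded below, because otherwise \<open>x i\<close> would come from every earlier time and hence lie in
    the intersection of the filtration, which is zero.
  \<^item> Consequently the functional \<open>f \<mapsto> \<psi> 0 f i\<close> vanishes on an early step of the filtration and
    depends on finitely many terms of \<open>f\<close> only. It takes the value \<open>1\<close> at \<open>x i\<close>, so it is nonzero at
    some unit vector.

  Thus \<open>i\<close> belongs to the finite support of \<open>\<psi> 0 (unit_vec (g n))\<close> for some \<open>n\<close>, and there are
  only countably many such \<open>i\<close>.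
\<close>

lemma interval_sum_not_interleaved_filtered_sequences:
  fixes A :: "'i set" and g :: "nat \<Rightarrow> 'x"
  assumes J: "\<And>i. i \<in> A \<Longrightarrow> is_interval (J i)" and g: "inj g"
  shows "\<not> interleaved s (interval_sum A J :: ('k::field, 'i) pers) (filtered_sequences g)"
proof
  let ?D = "interval_sum A J :: ('k, 'i) pers" and ?W = "filtered_sequences g :: ('k, 'x) pers"
  assume "interleaved s ?D ?W"
  then obtain \<phi> \<psi> where \<phi>: "pers_hom s ?D ?W \<phi>" and \<psi>: "pers_hom s ?W ?D \<psi>" and s: "0 \<le> s"
    and \<psi>\<phi>: "\<And>a v. v \<in> space_at ?D a \<Longrightarrow> \<psi> (a + s) (\<phi> a v) = transition ?D a (a + 2 * s) v"
    and \<phi>\<psi>: "\<And>a w. w \<in> space_at ?W a \<Longrightarrow> \<phi> (a + s) (\<psi> a w) = transition ?W a (a + 2 * s) w"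
    unfolding interleaved_def by blast
  have D: "?D \<in> PM" using J by (rule interval_sum_PM)
  have W: "?W \<in> PM" by (rule filtered_sequences_PM)
  have W_iff: "f \<in> space_at ?W a \<longleftrightarrow>
      f \<in> supported (range g) \<and> (\<forall>n. f (g n) \<noteq> 0 \<longrightarrow> - real n \<le> a)" for f a
    using g by (auto simp: filtered_sequences_def barcode_module_def supported_def)
  have W0: "space_at ?W a = supported (range g)" if "0 \<le> a" for a
    using that by (auto simp: W_iff intro: order_trans[of _ 0])
  have W_tr: "transition ?W a b f = f" if "a \<le> b" "f \<in> space_at ?W a" for a b f
    using that by (fastforce simp: filtered_sequences_def barcode_module_def fun_eq_iff)
  have \<phi>_in: "\<phi> a v \<in> space_at ?W (a + s)" if "v \<in> space_at ?D a" for a v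
    using \<phi> that by (simp add: pers_hom_def linear_on_def)
  have \<psi>_in: "\<psi> a w \<in> space_at ?D (a + s)" if "w \<in> space_at ?W a" for a w
    using \<psi> that by (simp add: pers_hom_def linear_on_def)
  have \<phi>_nat: "\<phi> b (transition ?D a b v) = \<phi> a v" if "a \<le> b" "v \<in> space_at ?D a" for a b v
    using \<phi> that W_tr[OF _ \<phi>_in[OF that(2)], of "b + s"] by (simp add: pers_hom_def)
  have \<psi>_nat: "\<psi> b w = transition ?D (a + s) (b + s) (\<psi> a w)"
    if "a \<le> b" "w \<in> space_at ?W a" for a b w
    using \<psi> that W_tr[OF that] unfolding pers_hom_def by metis
  have \<phi>0: "\<phi> a 0 = 0" for a
    using \<phi> PM_D(6)[OF D, of a] by (intro linear_on_zero) (auto simp: pers_hom_def)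
  have \<psi>_lin: "linear_on (space_at ?W a) (space_at ?D (a + s)) (\<psi> a)" for a
    using \<psi> by (simp add: pers_hom_def)
  have e: "unit_vec i \<in> space_at ?D a" if "i \<in> A" "a \<in> J i" for i a
    using that by (auto simp: space_at_interval_sum intro: unit_vec_in_fin_supported)
  have e_tr: "transition ?D a b (unit_vec i) = (if b \<in> J i then unit_vec i else 0)" for a b i
    by (auto simp: barcode_module_def unit_vec_def fun_eq_iff)
  have tr_at: "transition ?D a b v i = (if b \<in> J i then v i else 0)" for a b v i
    by (simp add: barcode_module_def)

  define x where "x i = \<phi> s (unit_vec i)" for i
  define P where "P = (\<Union>n. {i. \<psi> 0 (unit_vec (g n)) i \<noteq> 0})"
  have u_in: "unit_vec (g n) \<in> space_at ?W 0" for n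
    by (simp add: W0) (simp add: supported_def unit_vec_def)
  have "countable P"
    unfolding P_def
  proof (rule countable_UN[OF _ countable_finite])
    fix n
    have "\<psi> 0 (unit_vec (g n)) \<in> fin_supported {i \<in> A. 0 + s \<in> J i}"
      using \<psi>_in[OF u_in[of n]] unfolding space_at_interval_sum .
    then show "finite {i. \<psi> 0 (unit_vec (g n)) i \<noteq> 0}" by (simp add: fin_supported_def)
  qed simp
  have x_P: "i \<in> P" if i: "i \<in> A" "s \<in> J i" and nz: "x i \<noteq> 0" for i
  proof (rule ccontr)
    assume "i \<notin> P"
    then have P0: "\<psi> 0 (unit_vec (g n)) i = 0" for n by (auto simp: P_def)
    \<comment> \<open>The inclusion maps of the target never kill \<open>x i\<close>, so the generator cannot die.\<close>
    have J_up: "b \<in> J i" if "s \<le> b" for b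
      using \<phi>_nat[OF that e[OF i]] nz \<phi>0 by (auto simp: e_tr x_def split: if_splits)
    obtain m :: nat where m: "- real m \<notin> J i"
    proof (rule ccontr)
      assume "\<not> thesis"
      with that have all: "- real m \<in> J i" for m by blast
      have "x i (g n) = 0" for n
      proof -
        obtain m :: nat where mn: "real n + s < real m" using reals_Archimedean2 by blast
        have "x i = \<phi> (- real m) (unit_vec i)"
          using \<phi>_nat[OF _ e[OF i(1) all[of m]], of s] s i(2) by (simp add: e_tr x_def)
        then have "x i \<in> space_at ?W (- real m + s)" using \<phi>_in[OF e[OF i(1) all[of m]]] by simp
        then show ?thesis using mn unfolding W_iff by force
      qed
      moreover have "x i \<in> supported (range g)"
        using \<phi>_in[OF e[OF i]] by (simp add: x_def W_iff)
      ultimately have "x i = 0" by (auto simp: supported_def fun_eq_iff)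
      with nz show False by simp
    qed
    have xW: "x i \<in> space_at ?W 0"
      using \<phi>_in[OF e[OF i]] s by (simp add: x_def W0)
    \<comment> \<open>The aim is \<open>x i \<in> K\<close>: both the tail \<open>f\<close> of \<open>x i\<close> and its finite initial part lie in \<open>K\<close>.\<close>
    define K where "K = {f \<in> space_at ?W 0. \<psi> 0 f i = 0}"
    have K: "fun_vs.subspace K"
      using PM_D(1)[OF W, of 0] linear_on_zero[OF \<psi>_lin[of 0] PM_D(6)[OF W]] \<psi>_lin[of 0]
      by (auto simp: K_def fun_vs.subspace_def linear_on_def fscale_def)
    \<comment> \<open>The tail must lie in the space at time \<open>- m - s\<close>, so that \<open>\<psi>\<close> sends it to time \<open>- m\<close>,
      before coordinate \<open>i\<close> is born.\<close>
    obtain N :: nat where N: "real m + s \<le> real N" using real_arch_simple by blast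
    define f where "f = (\<lambda>y. if y \<in> g ` {..<N} then 0 else x i y)"
    have "f \<in> space_at ?W (- real m - s)"
    proof -
      have "f \<in> supported (range g)" using xW by (auto simp: f_def W_iff supported_def)
      moreover have "- real n \<le> - real m - s" if "f (g n) \<noteq> 0" for n
      proof -
        have "\<not> n < N" using that by (auto simp: f_def)
        then show ?thesis using N by linarith
      qed
      ultimately show ?thesis by (simp add: W_iff)
    qed
    moreover from this have "f \<in> space_at ?W 0" using s by (auto simp: W_iff)
    ultimately have "f \<in> K"
    proof -
      assume f: "f \<in> space_at ?W (- real m - s)" "f \<in> space_at ?W 0"
      have "\<psi> (- real m - s) f \<in> space_at ?D (- real m)" using \<psi>_in[OF f(1)] by simp
      then have "\<psi> (- real m - s) f i = 0"
        using m by (auto simp: barcode_module_def)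
      moreover have "\<psi> 0 f = transition ?D (- real m) s (\<psi> (- real m - s) f)"
        using \<psi>_nat[OF _ f(1), of 0] s by simp
      ultimately show ?thesis using f(2) by (simp add: K_def tr_at)
    qed
    moreover have "x i - f \<in> K"
    proof -
      have "x i - f \<in> fin_supported (g ` {..<N})"
        using xW by (auto simp: fin_supported_finite supported_def f_def split: if_splits)
      moreover have "unit_vec ` g ` {..<N} \<subseteq> K" using u_in P0 by (auto simp: K_def)
      ultimately show ?thesis
        using fun_vs.span_minimal[OF _ K] unfolding fin_supported_eq_span by blast
    qed
    ultimately have "x i \<in> K" using fun_vs.subspace_add[OF K] by force
    then have "\<psi> 0 (x i) i = 0" by (simp add: K_def)
    \<comment> \<open>The two ways to move \<open>x i\<close> on to time \<open>3 * s\<close> disagree at coordinate \<open>i\<close>.\<close>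
    moreover have "\<psi> (2 * s) (x i) = transition ?D s (3 * s) (\<psi> 0 (x i))"
      using \<psi>_nat[OF _ xW, of "2 * s"] s by simp
    moreover have "\<psi> (2 * s) (x i) = unit_vec i"
      using \<psi>\<phi>[OF e[OF i]] J_up[of "3 * s"] s by (simp add: e_tr x_def)
    ultimately have "unit_vec i i = (0::'k)" by (metis tr_at)
    then show False by (simp add: unit_vec_def)
  qed
  have "supported (range g) \<subseteq> fun_vs.span (x ` P)"
  proof
    fix f :: "'x \<Rightarrow> 'k" assume "f \<in> supported (range g)"
    then have f: "f \<in> space_at ?W 0" by (simp add: W0)
    have "f = \<phi> s (\<psi> 0 f)" using \<phi>\<psi>[OF f] W_tr[OF _ f] s by simp
    moreover have "\<psi> 0 f \<in> space_at ?D s" using \<psi>_in[OF f] by simp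
    ultimately have "f \<in> \<phi> s ` space_at ?D s" by blast
    also have "\<dots> = fun_vs.span (x ` {i \<in> A. s \<in> J i})"
      unfolding x_def
    proof (rule interval_sum_linear_image)
      show "linear_on (space_at ?D s) (space_at ?W (s + s)) (\<phi> s)"
        using \<phi> unfolding pers_hom_def by blast
    qed (rule J)
    also have "\<dots> = fun_vs.span (x ` {i \<in> A. s \<in> J i} - {0})" by simp
    also have "\<dots> \<subseteq> fun_vs.span (x ` P)"
      using x_P by (intro fun_vs.span_mono) auto
    finally show "f \<in> fun_vs.span (x ` P)" .
  qed
  then show False
    using supported_not_countably_spanned[OF g countable_image[OF \<open>countable P\<close>]] by blast
qed

lemma ID_not_interleaved_filtered_sequences:
  assumes A: "A \<in> ID" and g: "inj g"
  shows "\<not> interleaved s A (filtered_sequences g)"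
proof
  assume int: "interleaved s A (filtered_sequences g)"
  obtain I :: "('a, 'b) index set" and J where I: "A \<in> PM" "interval_decomposition A I J"
    using A unfolding ID_def mem_Collect_eq by metis
  have "\<And>i. i \<in> I \<Longrightarrow> is_interval (J i)" using I(2) by (simp add: interval_decomposition_def)
  then show False
    using interval_sum_not_interleaved_filtered_sequences[OF _ g]
      interval_decomposition_interleaved[OF I int] by blast
qed

section \<open>Evaluation of the distances\<close>

lemma enveloping_distance_Infty:
  assumes "B \<in> \<B>" "\<And>s A. A \<in> \<A> \<Longrightarrow> \<not> interleaved s A B"
  shows "enveloping_distance \<A> \<B> = Infty"
proof -
  have "\<not> envelops \<A> \<B> r" for r
  proof
    assume "envelops \<A> \<B> r"
    then obtain A where "A \<in> \<A>" "interleaved (r + 1) A B"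
      using assms(1) unfolding envelops_def by (meson less_add_one)
    with assms(2) show False by blast
  qed
  moreover have "\<not> (\<forall>B\<in>\<B>. \<exists>s. \<exists>A\<in>\<A>. interleaved s A B)" using assms by blast
  ultimately show ?thesis by (simp add: enveloping_distance_def)
qed

lemma enveloping_distance_Infty_minus:
  assumes "\<And>B. B \<in> \<B> \<Longrightarrow> \<exists>s. \<exists>A\<in>\<A>. interleaved s A B"
    and "\<And>s. 0 \<le> s \<Longrightarrow> \<exists>B\<in>\<B>. \<forall>A\<in>\<A>. \<not> interleaved s A B"
  shows "enveloping_distance \<A> \<B> = Infty_minus"
proof -
  have "\<not> envelops \<A> \<B> r" if "0 \<le> r" for r
  proof
    assume env: "envelops \<A> \<B> r"
    have "0 \<le> r + 1" using that by simp
    then obtain B where B: "B \<in> \<B>" "\<forall>A\<in>\<A>. \<not> interleaved (r + 1) A B"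
      using assms(2) by blast
    with env show False unfolding envelops_def by (meson less_add_one)
  qed
  then show ?thesis using assms(1) by (auto simp: enveloping_distance_def)
qed

lemma enveloping_distance_Fin:
  assumes "0 \<le> r" "envelops \<A> \<B> r"
    and "\<And>s. 0 \<le> s \<Longrightarrow> s < r \<Longrightarrow> \<exists>B\<in>\<B>. \<forall>A\<in>\<A>. \<not> interleaved s A B"
  shows "enveloping_distance \<A> \<B> = Fin r"
proof -
  have "r \<le> t" if t: "0 \<le> t" "envelops \<A> \<B> t" for t
  proof (rule ccontr)
    assume "\<not> r \<le> t"
    then obtain s where s: "t < s" "s < r" using dense[of t r] by auto
    obtain B where "B \<in> \<B>" "\<forall>A\<in>\<A>. \<not> interleaved s A B"
      using assms(3)[of s] s t(1) by (meson less_imp_le order_trans)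
    with t(2) s(1) show False unfolding envelops_def by blast
  qed
  then have "Inf {t. 0 \<le> t \<and> envelops \<A> \<B> t} = r"
    using assms(1,2) by (intro cInf_eq_minimum) auto
  then show ?thesis using assms(1,2) by (auto simp: enveloping_distance_def)
qed

lemma zero_module:
  "(interval_sum {} J :: ('k::field, 'x) pers) \<in> ZERO"
  "(interval_sum {} J :: ('k::field, 'x) pers) \<in> FFID_in c d"
proof -
  have "(interval_sum {} J :: ('k, 'x) pers) \<in> PM" by (rule interval_sum_PM) simp
  then show "(interval_sum {} J :: ('k, 'x) pers) \<in> ZERO"
    by (simp add: ZERO_def space_at_interval_sum_span)
  show "(interval_sum {} J :: ('k, 'x) pers) \<in> FFID_in c d"
    by (rule interval_sum_classes(6)) auto
qed

text \<open>
  Both interleaving maps are zero; the only condition left is that the structure maps of \<open>M\<close> of length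
  \<open>2 * s\<close> vanish.
\<close>

lemma ZERO_interleaved:
  assumes Z: "Z \<in> ZERO" and M: "M \<in> PM" and s: "0 \<le> s"
    and small: "\<And>a v. v \<in> space_at M a \<Longrightarrow> transition M a (a + 2 * s) v = 0"
  shows "interleaved s Z M"
proof -
  have Z: "Z \<in> PM" "\<And>a. space_at Z a = {0}" using Z by (auto simp: ZERO_def)
  have Z0: "transition Z a b 0 = 0" if "a \<le> b" for a b
    using PM_D(5)[OF Z(1) that PM_D(6)[OF Z(1)]] Z(2) by simp
  have M0: "transition M a b 0 = 0" if "a \<le> b" for a b
    using linear_on_zero[OF PM_D(2)[OF M that] PM_D(6)[OF M]] .
  have "pers_hom s Z M (\<lambda>_ _. 0)" "pers_hom s M Z (\<lambda>_ _. 0)"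
    unfolding pers_hom_def linear_on_def using Z(2) Z0 M0 PM_D(6)[OF M] by simp_all
  then show ?thesis
    unfolding interleaved_def using s small Z0 Z(2)
    by (intro conjI exI[of _ "\<lambda>_ _. 0"]) simp_all
qed

lemma ZERO_interleaved_FFID_in:
  assumes "Z \<in> ZERO" "M \<in> FFID_in c d" "c < d" "(d - c) / 2 < s"
  shows "interleaved s Z M"
proof (rule ZERO_interleaved[OF assms(1)])
  show "M \<in> PM" using assms(2) by (simp add: FFID_in_def)
  show "transition M a (a + 2 * s) v = 0" if "v \<in> space_at M a" for a v
    using assms that by (intro FFID_in_transition_zero[OF assms(2)]) simp_all
qed (use assms in simp)

lemma ZERO_interleaved_FFID:
  assumes "Z \<in> ZERO" "M \<in> FFID"
  shows "\<exists>s. interleaved s Z M"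
proof -
  obtain c d where "c < d" "M \<in> FFID_in c d" using FFID_bounded[OF assms(2)] by metis
  then show ?thesis using ZERO_interleaved_FFID_in[OF assms(1)] gt_ex by metis
qed

theorem proposition3p17:
  fixes c d :: real
    and E :: "('k::field, 'y) pers set \<Rightarrow> ('k, 'x) pers set \<Rightarrow> envdist"
  defines "E \<equiv> enveloping_distance"
  assumes "c < d" and "infinite (UNIV :: 'x set)"
  shows
    "(E ZERO (FFID_in c d) = Fin ((d - c) / 2) \<and>
      E (FFID_in c d) FFID = Infty_minus \<and>
      E ZERO FFID = Infty_minus \<and>
      E EPH FFID = Infty_minus \<and>
      E EPH (FFID_in c d) = Fin ((d - c) / 2)) \<and>
     (E CFID FID = Infty \<and>
      E QTAME CFID = Infty) \<and>
     (E FFID FID = Infty \<and>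
      E FFID CFID = Infty \<and>
      E CFID CID = Infty \<and>
      E FID CID = Infty \<and>
      E FID PFD = Infty \<and>
      E CID ID = Infty \<and>
      E PFD ID = Infty \<and>
      E EPH ID = Infty \<and>
      E EPH QTAME = Infty \<and>
      E ID PM = Infty \<and>
      E QTAME PM = Infty \<and>
      E QTAME CID = Infty)"
proof -
  obtain g :: "nat \<Rightarrow> 'x" where g: "inj g"
    using infinite_countable_subset[OF assms(3)] by blast
  define Z :: "('k, 'y) pers" where "Z = interval_sum {} (\<lambda>_. {})"
  have Z: "Z \<in> ZERO" "Z \<in> EPH" "Z \<in> FFID_in c d"
    using zero_module[of "\<lambda>_. {}"] ZERO_subset_EPH by (auto simp: Z_def)
  define I :: "real \<Rightarrow> real \<Rightarrow> ('k, 'x) pers" where "I p q = interval_sum {g 0} (\<lambda>_. {p..q})" for p q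
  have I: "I p q \<in> FFID" "I p q \<in> FFID_in p q" if "p \<le> q" for p q
    unfolding I_def by (rule interval_sum_classes(5,6); simp add: is_interval_cc that)+
  have EPH_I: "\<not> interleaved s A (I p q)" if "A \<in> EPH" "0 \<le> s" "2 * s < q - p"
    for s p q and A :: "('k, 'y) pers"
    unfolding I_def by (rule EPH_not_interleaved_long_interval[OF that])
  have long: "\<exists>B\<in>FFID. \<forall>A\<in>EPH. \<not> interleaved s (A :: ('k, 'y) pers) (B :: ('k, 'x) pers)" if "0 \<le> s" for s
    using I(1)[of 0 "2 * s + 1"] EPH_I[where p = 0 and q = "2 * s + 1"] that
    by (intro bexI[of _ "I 0 (2 * s + 1)"]) auto
  have long': "\<exists>B\<in>FFID. \<forall>A\<in>FFID_in c d. \<not> interleaved s (A :: ('k, 'y) pers) (B :: ('k, 'x) pers)"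
    if "0 \<le> s" for s
  proof (intro bexI[of _ "I 0 (2 * s + (d - c) + 1)"] ballI)
    fix A :: "('k, 'y) pers" assume "A \<in> FFID_in c d"
    then show "\<not> interleaved s A (I 0 (2 * s + (d - c) + 1))"
      unfolding I_def using assms(2) that
      by (rule FFID_in_not_interleaved_long_interval) simp
  qed (use that assms(2) in \<open>simp add: I\<close>)
  have short: "\<exists>B\<in>FFID_in c d. \<forall>A\<in>EPH. \<not> interleaved s (A :: ('k, 'y) pers) (B :: ('k, 'x) pers)"
    if "0 \<le> s" "s < (d - c) / 2" for s
    using I(2)[of c d] EPH_I[where p = c and q = d] that assms(2)
    by (intro bexI[of _ "I c d"]) auto
  have near: "interleaved s Z B" if "B \<in> FFID_in c d" "(d - c) / 2 < s"
    for s and B :: "('k, 'x) pers"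
    using ZERO_interleaved_FFID_in[OF Z(1) that(1) assms(2) that(2)] .
  have half: "0 \<le> (d - c) / 2" using assms(2) by simp
  have env: "envelops \<A> (FFID_in c d :: ('k, 'x) pers set) ((d - c) / 2)" if "Z \<in> \<A>" for \<A>
    unfolding envelops_def using near that by metis
  have far: "\<exists>s. \<exists>A\<in>\<A>. interleaved s A B" if "Z \<in> \<A>" "B \<in> FFID"
    for \<A> and B :: "('k, 'x) pers"
    using ZERO_interleaved_FFID[OF Z(1) that(2)] that(1) by metis

  define R :: "('k, 'x) pers" where "R = interval_sum {g 0} (\<lambda>_. UNIV)"
  have R: "R \<in> ID" "R \<in> CID" "R \<in> FID"
    unfolding R_def by (rule interval_sum_classes; simp add: is_interval_univ)+
  have R_QTAME: "R \<in> QTAME"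
    unfolding R_def by (rule subsetD[OF PFD_subset_QTAME interval_sum_PFD])
      (simp_all add: is_interval_univ)
  define S :: "('k, 'x) pers" where "S = nested_intervals g"
  have S: "S \<in> CFID" "S \<in> CID" "S \<in> ID" "S \<in> PM"
    unfolding S_def by (rule nested_intervals_classes)+

  have CFID_R: "\<not> interleaved s A R" if "A \<in> CFID" for s and A :: "('k, 'y) pers"
    unfolding R_def by (rule CFID_not_interleaved_line[OF that])
  have FFID_R: "\<not> interleaved s A R" if "A \<in> FFID" for s and A :: "('k, 'y) pers"
    by (rule CFID_R[OF subsetD[OF FFID_subset_CFID that]])
  have EPH_R: "\<not> interleaved s A R" if "A \<in> EPH" for s and A :: "('k, 'y) pers"
    unfolding R_def by (rule EPH_not_interleaved_line[OF that])
  have QTAME_S: "\<not> interleaved s A S" if "A \<in> QTAME" for s and A :: "('k, 'y) pers"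
    unfolding S_def by (rule QTAME_not_interleaved_nested[OF that g])
  have PFD_S: "\<not> interleaved s A S" if "A \<in> PFD" for s and A :: "('k, 'y) pers"
    by (rule QTAME_S[OF subsetD[OF PFD_subset_QTAME that]])
  have FID_S: "\<not> interleaved s A S" if "A \<in> FID" for s and A :: "('k, 'y) pers"
    unfolding S_def by (rule FID_not_interleaved_nested[OF that g])
  have FFID_S: "\<not> interleaved s A S" if "A \<in> FFID" for s and A :: "('k, 'y) pers"
    by (rule FID_S[OF subsetD[OF FFID_subset_FID that]])

  note inf = enveloping_distance_Infty
  have "E ZERO (FFID_in c d) = Fin ((d - c) / 2)"
    unfolding E_def
  proof (rule enveloping_distance_Fin[OF half env[OF Z(1)]])
    fix s assume "0 \<le> s" "s < (d - c) / 2"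
    from short[OF this]
    show "\<exists>B\<in>FFID_in c d. \<forall>A\<in>ZERO. \<not> interleaved s (A :: ('k, 'y) pers) (B :: ('k, 'x) pers)"
      using ZERO_subset_EPH by (meson subsetD)
  qed
  moreover have "E EPH (FFID_in c d) = Fin ((d - c) / 2)"
    unfolding E_def by (rule enveloping_distance_Fin[OF half env[OF Z(2)] short])
  moreover have "E (FFID_in c d) FFID = Infty_minus"
    unfolding E_def by (rule enveloping_distance_Infty_minus[OF far[OF Z(3)] long'])
  moreover have "E EPH FFID = Infty_minus"
    unfolding E_def by (rule enveloping_distance_Infty_minus[OF far[OF Z(2)] long])
  moreover have "E ZERO FFID = Infty_minus"
    unfolding E_def
  proof (rule enveloping_distance_Infty_minus[OF far[OF Z(1)]])
    fix s :: real assume "0 \<le> s"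
    from long[OF this]
    show "\<exists>B\<in>FFID. \<forall>A\<in>ZERO. \<not> interleaved s (A :: ('k, 'y) pers) (B :: ('k, 'x) pers)"
      using ZERO_subset_EPH by (meson subsetD)
  qed
  moreover have "E CFID FID = Infty" unfolding E_def by (rule inf[OF R(3) CFID_R])
  moreover have "E FFID FID = Infty" unfolding E_def by (rule inf[OF R(3) FFID_R])
  moreover have "E CFID CID = Infty" unfolding E_def by (rule inf[OF R(2) CFID_R])
  moreover have "E EPH ID = Infty" unfolding E_def by (rule inf[OF R(1) EPH_R])
  moreover have "E EPH QTAME = Infty" unfolding E_def by (rule inf[OF R_QTAME EPH_R])
  moreover have "E QTAME CFID = Infty" unfolding E_def by (rule inf[OF S(1) QTAME_S])
  moreover have "E QTAME CID = Infty" unfolding E_def by (rule inf[OF S(2) QTAME_S])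
  moreover have "E QTAME PM = Infty" unfolding E_def by (rule inf[OF S(4) QTAME_S])
  moreover have "E FFID CFID = Infty" unfolding E_def by (rule inf[OF S(1) FFID_S])
  moreover have "E FID CID = Infty" unfolding E_def by (rule inf[OF S(2) FID_S])
  moreover have "E PFD ID = Infty" unfolding E_def by (rule inf[OF S(3) PFD_S])
  moreover have "E FID PFD = Infty"
    unfolding E_def by (rule inf[OF staircase_PFD[OF g] FID_not_interleaved_staircase[OF _ g]])
  moreover have "E CID ID = Infty"
    unfolding E_def
    by (rule inf[OF constant_sequences_ID CID_not_interleaved_constant_sequences[OF _ g]])
  moreover have "E ID PM = Infty"
    unfolding E_def
    by (rule inf[OF filtered_sequences_PM ID_not_interleaved_filtered_sequences[OF _ g]])
  ultimately show ?thesis by (intro conjI)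
qed

end
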